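(* Let $I=[0,T]$ with $T>0$. Let $h\colon\mathbb{R}^N\to\mathbb{R}^N$ be a continuous mapping such that $|h(x)|\leqslant|x|$ for every $x\in\mathbb{R}^N$, and assume that the fixed point set $\{x\in\mathbb{R}^N\colon h(x)=x\}$ of $h$ is compact. Let $F\colon I\times\mathbb{R}^N\multimap\mathbb{R}^N$ be a Carathéodory map and suppose there exists a monotone coercive weakly negatively guiding potential $V\colon\mathbb{R}^N\to\mathbb{R}$ for $F$. Then the nonlocal Cauchy problem $$\dot{x}(t)\in F(t,x(t))\ \text{ for a.e. } t\in I,\qquad x(0)=\frac{1}{T}\int_0^T h(x(t))\,dt$$ possesses at least one solution $x\in AC(I,\mathbb{R}^N)$.
   Context: $AC(I,\mathbb{R}^N)$ is the space of absolutely continuous functions $I\to\mathbb{R}^N$; solutions are absolutely continuous functions. $|\cdot|$ and $\langle\cdot,\cdot\rangle$ are the Euclidean norm and inner product in $\mathbb{R}^N$. A multivalued map $F\colon X\multimap Z$ assigns to each $x\in X$ a nonempty subset $F(x)\subset Z$. Carathéodory map: $F\colon I\times\mathbb{R}^N\multimap\mathbb{R}^N$ with nonempty convex compact values such that ($F_1$) for every fixed $x\in\mathbb{R}^N$ the multimap $t\mapsto F(t,x)$ is measurable, i.e. $\{t\in I\colon F(t,x)\subset A\}$ is Lebesgue measurable for every closed $A\subset\mathbb{R}^N$; ($F_2$) for a.e. $t\in I$ the multimap $x\mapsto F(t,x)$ is upper semicontinuous; ($F_3$) there is $\mu\in L^1(I,\mathbb{R})$ with $\sup\{|y|\colon y\in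 F(t,x)\}\leqslant\mu(t)(1+|x|)$ for every $(t,x)\in I\times\mathbb{R}^N$. $V$ is monotone if $|x|\leqslant|y|$ implies $V(x)\leqslant V(y)$ for all $x,y\in\mathbb{R}^N$. $V$ is coercive if $V(x)\to+\infty$ as $|x|\to+\infty$. Weakly negatively guiding potential for $F$: $V\in C^1(\mathbb{R}^N,\mathbb{R})$ which is nonsingular, i.e. there is $R>0$ with $\nabla V(x)\neq 0$ for all $|x|\geqslant R$, and such that there is $R>0$ such that for all $|x|\geqslant R$ and all $t\in I$ there exists $y\in F(t,x)$ with $\langle\nabla V(x),y\rangle\leqslant 0$. *)

theory Defs
  imports "HOL-Analysis.Analysis"
begin

text \<open>
  Absolute continuity in the \<open>\<epsilon>\<close>-\<open>\<delta>\<close> sense, over finite families of nonoverlapping compact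
  subintervals of \<open>I\<close>. (The library constant \<open>absolutely_continuous\<close> is about measures.)
\<close>

definition absolutely_continuous_on :: "real set \<Rightarrow> (real \<Rightarrow> 'a::metric_space) \<Rightarrow> bool" where
  "absolutely_continuous_on I f \<longleftrightarrow>
    (\<forall>\<epsilon>>0. \<exists>\<delta>>0. \<forall>(n::nat) a b.
      (\<forall>k<n. a k \<le> b k \<and> {a k..b k} \<subseteq> I) \<longrightarrow>
      disjoint_family_on (\<lambda>k. {a k<..<b k}) {..<n} \<longrightarrow>
      (\<Sum>k<n. b k - a k) < \<delta> \<longrightarrow>
      (\<Sum>k<n. dist (f (a k)) (f (b k))) < \<epsilon>)"

definition usc_multimap :: "('a::topological_space \<Rightarrow> 'b::topological_space set) \<Rightarrow> bool" where
  "usc_multimap G \<longleftrightarrow> (\<forall>U. open U \<longrightarrow> open {x. G x \<subseteq> U})"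

definition measurable_multimap_on :: "real set \<Rightarrow> (real \<Rightarrow> 'b::topological_space set) \<Rightarrow> bool" where
  "measurable_multimap_on I G \<longleftrightarrow> (\<forall>A. closed A \<longrightarrow> {t \<in> I. G t \<subseteq> A} \<in> sets lebesgue)"

text \<open>
  A multimap on \<open>I \<times> \<real>\<^sup>N\<close> is a curried function whose values at times outside \<open>I\<close> are irrelevant.
  The supremum below is over a nonempty bounded set because the values are nonempty and compact.
\<close>

definition caratheodory_map ::
    "real set \<Rightarrow> (real \<Rightarrow> 'a::euclidean_space \<Rightarrow> 'a set) \<Rightarrow> bool" where
  "caratheodory_map I F \<longleftrightarrow>
    (\<forall>t\<in>I. \<forall>x. F t x \<noteq> {} \<and> convex (F t x) \<and> compact (F t x)) \<and>
    (\<forall>x. measurable_multimap_on I (\<lambda>t. F t x)) \<and>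
    (AE t in lebesgue_on I. usc_multimap (F t)) \<and>
    (\<exists>\<mu>::real \<Rightarrow> real. \<mu> absolutely_integrable_on I \<and>
      (\<forall>t\<in>I. \<forall>x. (SUP y\<in>F t x. norm y) \<le> \<mu> t * (1 + norm x)))"

definition norm_monotone :: "('a::real_normed_vector \<Rightarrow> real) \<Rightarrow> bool" where
  "norm_monotone V \<longleftrightarrow> (\<forall>x y. norm x \<le> norm y \<longrightarrow> V x \<le> V y)"

definition coercive :: "('a::real_normed_vector \<Rightarrow> real) \<Rightarrow> bool" where
  "coercive V \<longleftrightarrow> filterlim V at_top at_infinity"

text \<open>\<open>V\<close> is of class \<open>C\<^sup>1\<close> with (necessarily unique) gradient field \<open>G\<close>.\<close>

definition has_C1_gradient ::
    "('a::euclidean_space \<Rightarrow> real) \<Rightarrow> ('a \<Rightarrow> 'a) \<Rightarrow> bool" where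
  "has_C1_gradient V G \<longleftrightarrow> (\<forall>x. GDERIV V x :> G x) \<and> continuous_on UNIV G"

definition weakly_negatively_guiding_potential ::
    "real set \<Rightarrow> (real \<Rightarrow> 'a::euclidean_space \<Rightarrow> 'a set) \<Rightarrow> ('a \<Rightarrow> real) \<Rightarrow> bool" where
  "weakly_negatively_guiding_potential I F V \<longleftrightarrow>
    (\<exists>G. has_C1_gradient V G \<and>
      (\<exists>R>0. \<forall>x. norm x \<ge> R \<longrightarrow> G x \<noteq> 0) \<and>
      (\<exists>R>0. \<forall>x. norm x \<ge> R \<longrightarrow> (\<forall>t\<in>I. \<exists>y\<in>F t x. G x \<bullet> y \<le> 0)))"

definition inclusion_solution_on ::
    "real set \<Rightarrow> (real \<Rightarrow> 'a::euclidean_space \<Rightarrow> 'a set) \<Rightarrow> (real \<Rightarrow> 'a) \<Rightarrow> bool" where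
  "inclusion_solution_on I F x \<longleftrightarrow>
    absolutely_continuous_on I x \<and>
    (AE t in lebesgue_on I. \<exists>v\<in>F t (x t). (x has_vector_derivative v) (at t within I))"

end

theory Submission
  imports Defs "HOL-Complex_Analysis.Great_Picard"
begin

text \<open>
  Since \<open>V\<close> is monotone in the norm, its gradient at a point \<open>x\<close> of large norm is a positive
  multiple of \<open>x\<close>, so the guiding condition says that some \<open>y \<in> F t x\<close> satisfies \<open>x \<bullet> y \<le> 0\<close>.
  Measurable selections of \<open>F t q\<close> with \<open>q \<bullet> y \<le> 0\<close> at finitely many points \<open>q\<close>, glued by a
  partition of unity, give single-valued fields whose Euler polygons depend continuously on the
  initial value and almost preserve a large ball. Because \<open>norm (h x) \<le> norm x\<close>, the map sending
  the initial value to the mean of \<open>h\<close> along the polygon, followed by the projection, maps this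
  ball into itself, and Brouwer's theorem yields approximate solutions of the nonlocal problem.

  A subsequence converges uniformly by the Arzela--Ascoli theorem. Suitable convex combinations of
  the velocities converge almost everywhere, so upper semicontinuity and convexity put the limit
  velocity \<open>w t\<close> in \<open>F t (x t)\<close>, and Lebesgue's differentiation theorem identifies \<open>w\<close> with
  the derivative of \<open>x\<close>.
\<close>

section \<open>Indefinite integrals\<close>

text \<open>The guiding condition is weak: only some velocity in \<open>F t x\<close> points inward,
  and the solutions of the inclusion from a given initial value need not form a convex set.
  Single-valued fields leave the initial value as the only unknown, which brings the problem within
  reach of Brouwer in finite dimension. The half-space condition is imposed at finitely many grid
  points only, so the ball is not exactly invariant. The defect is measured through the squared
  norm, which grows along a polygon by at most \<open>3 * e * integral {0..T} m\<close>, whatever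
  the number of Euler steps. The same quantity bounds how far the projection moves the mean of
  \<open>h\<close>, hence also the error in the nonlocal condition at the Brouwer fixed point; it
  vanishes with \<open>e\<close>. In the limit, velocities are bounded only by an integrable
  \<open>m\<close>, so their squares need not be integrable. A weight restores a Hilbert space
  argument, and what it yields is stronger than a weak limit: pointwise convergence a.e. of convex
  combinations, which is the form in which upper semicontinuity can be used at each fixed
  time.\<close>

lemma integral_small_on_small_sets:
  fixes f :: "'a::euclidean_space \<Rightarrow> real"
  assumes f: "f absolutely_integrable_on S" and S: "S \<in> sets lebesgue"
    and nonneg: "\<And>x. x \<in> S \<Longrightarrow> 0 \<le> f x" and "e > 0"
  obtains \<delta> where "\<delta> > 0"
    "\<And>A. \<lbrakk>A \<in> lmeasurable; A \<subseteq> S; measure lebesgue A < \<delta>\<rbrakk> \<Longrightarrow> integral A f < e"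
proof -
  \<comment> \<open>Truncation at height \<open>n\<close>: the excess \<open>g n\<close> has small
    integral over all of \<open>S\<close>, and the part below \<open>n\<close> costs at most
    \<open>n\<close> times the measure of the set.\<close>
  define g where "g = (\<lambda>(n::nat) x. max 0 (f x - real n))"
  have fint: "f integrable_on S"
    using f by (simp add: set_lebesgue_integral_eq_integral(1))
  have fm: "f \<in> borel_measurable (lebesgue_on S)"
    using absolutely_integrable_imp_borel_measurable[OF f S] .
  have gai: "g n absolutely_integrable_on S" for n
  proof (rule measurable_bounded_by_integrable_imp_absolutely_integrable[OF _ S fint])
    show "g n \<in> borel_measurable (lebesgue_on S)"
      unfolding g_def using fm by measurable
    show "norm (g n x) \<le> f x" if "x \<in> S" for x
      using nonneg[OF that] by (auto simp: g_def)
  qed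
  have gint: "g n integrable_on S" for n
    using gai by (simp add: set_lebesgue_integral_eq_integral(1))
  have "(\<lambda>n. integral S (g n)) \<longlonglongrightarrow> integral S (\<lambda>x. 0)"
  proof (rule dominated_convergence(2)[OF gint fint])
    show "norm (g n x) \<le> f x" if "x \<in> S" for n x
      using nonneg[OF that] by (auto simp: g_def)
    show "(\<lambda>n. g n x) \<longlonglongrightarrow> 0" if "x \<in> S" for x
    proof (rule tendsto_eventually)
      show "\<forall>\<^sub>F n in sequentially. g n x = 0"
        using eventually_ge_at_top[of "nat \<lceil>f x\<rceil>"]
        by eventually_elim (auto simp: g_def max_def; linarith)
    qed
  qed
  then have "\<forall>\<^sub>F n in sequentially. integral S (g n) < e/2"
    by (intro order_tendstoD) (use \<open>e > 0\<close> in auto)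
  then obtain n where n: "integral S (g n) < e/2"
    by (auto simp: eventually_sequentially)
  show thesis
  proof (rule that)
    \<comment> \<open>Dividing by \<open>n + 1\<close> instead of \<open>n\<close> covers
      \<open>n = 0\<close>.\<close>
    show "e / (2 * (real n + 1)) > 0" using \<open>e > 0\<close> by simp
    fix A assume A: "A \<in> lmeasurable" "A \<subseteq> S" "measure lebesgue A < e / (2 * (real n + 1))"
    have gA: "g n absolutely_integrable_on A" and fA: "f absolutely_integrable_on A"
      using A set_integrable_subset[OF gai] set_integrable_subset[OF f] by auto
    have ints: "g n integrable_on A" "f integrable_on A" "(\<lambda>x. real n) integrable_on A"
      using gA fA A by (auto simp: set_lebesgue_integral_eq_integral(1) integrable_on_const)
    have "integral A f \<le> integral A (\<lambda>x. g n x + real n)"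
      by (rule integral_le) (use ints in \<open>auto intro: integrable_add simp: g_def\<close>)
    also have "\<dots> = integral A (g n) + integral A (\<lambda>x. real n)"
      by (rule integral_add) (use ints in auto)
    also have "integral A (\<lambda>x. real n) = real n * measure lebesgue A"
      using A(1) lmeasure_integral[of A] integral_mult_right[of A "real n" "\<lambda>x. 1"] by simp
    also have "real n * measure lebesgue A \<le> (real n + 1) * measure lebesgue A"
      by (simp add: distrib_right)
    also have "\<dots> < e/2"
      using A(3) by (simp add: field_simps)
    also have "integral A (g n) \<le> integral S (g n)"
      by (rule integral_subset_le) (use ints gint A in \<open>auto simp: g_def\<close>)
    finally show "integral A f < e" using n by simp
  qed
qed

text \<open>Bad points are Vitali-covered by short intervals whose integral exceeds
  \<open>\<epsilon>\<close> times their length. Chosen inside an open \<open>U\<close> around the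
  zero set \<open>Z\<close>, disjoint ones have total length at most \<open>1 / \<epsilon>\<close>
  times the integral over \<open>U - Z\<close>, because \<open>f\<close> vanishes on
  \<open>Z\<close>; and \<open>U - Z\<close> can be made as small as desired. This is the covering
  argument behind Lebesgue differentiation, restricted to zeros of \<open>f\<close>.\<close>

lemma negligible_zeros_with_large_averages:
  fixes f :: "real \<Rightarrow> real"
  assumes f: "f absolutely_integrable_on UNIV" and nonneg: "\<And>x. 0 \<le> f x" and "\<epsilon> > 0"
  shows "negligible {t. f t = 0 \<and>
           \<not> (\<exists>\<delta>>0. \<forall>a b. a \<le> t \<longrightarrow> t \<le> b \<longrightarrow> b - a < \<delta> \<longrightarrow> integral {a..b} f \<le> \<epsilon> * (b - a))}"
    (is "negligible ?E")
  unfolding negligible_outer_le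
proof (intro allI impI)
  fix \<eta> :: real assume "\<eta> > 0"
  \<comment> \<open>The target is \<open>\<epsilon> * \<eta>\<close> because lengths are recovered
    from integrals by dividing by \<open>\<epsilon>\<close>.\<close>
  obtain \<delta> where \<delta>: "\<delta> > 0"
    "\<And>A. \<lbrakk>A \<in> lmeasurable; A \<subseteq> UNIV; measure lebesgue A < \<delta>\<rbrakk> \<Longrightarrow> integral A f < \<epsilon> * \<eta>"
    by (rule integral_small_on_small_sets[OF f _ nonneg, of "\<epsilon> * \<eta>"]) (use \<open>\<epsilon> > 0\<close> \<open>\<eta> > 0\<close> in auto)
  define Z where "Z = {t. f t = 0}"
  have fm: "f \<in> borel_measurable lebesgue"
    using absolutely_integrable_imp_borel_measurable[OF f] by simp
  have Z: "Z \<in> sets lebesgue"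
    unfolding Z_def using measurable_sets[OF fm, of "{0}"] by (simp add: vimage_def)
  obtain U where U: "open U" "Z \<subseteq> U" "U - Z \<in> lmeasurable" "emeasure lebesgue (U - Z) < ennreal \<delta>"
    using sets_lebesgue_outer_open[OF Z \<open>\<delta> > 0\<close>] by blast
  have mU: "measure lebesgue (U - Z) < \<delta>"
    using U(3,4) \<open>\<delta> > 0\<close> by (simp add: emeasure_eq_measure2 ennreal_less_iff)
  have fint: "f integrable_on A" if "A \<in> sets lebesgue" for A
    using set_integrable_subset[OF f that] by (simp add: set_lebesgue_integral_eq_integral(1))
  define K where "K = {(a,b). a < b \<and> {a..b} \<subseteq> U \<and> integral {a..b} f > \<epsilon> * (b - a)}"
  define c where "c = (\<lambda>(a::real,b). (a+b)/2)"
  define r where "r = (\<lambda>(a::real,b). (b-a)/2)"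
  have cb: "cball (c i) (r i) = {fst i..snd i}" for i
    by (cases i) (auto simp: c_def r_def cball_eq_atLeastAtMost field_simps)
  have rpos: "0 < r i" if "i \<in> K" for i
    using that by (auto simp: K_def r_def)
  have cover: "\<exists>i. i \<in> K \<and> t \<in> cball (c i) (r i) \<and> r i < d" if t: "t \<in> ?E" and "0 < d" for t d
  proof -
    have "t \<in> U" using t U(2) by (auto simp: Z_def)
    then obtain d' where d': "d' > 0" "ball t d' \<subseteq> U"
      using \<open>open U\<close> openE by blast
    have "min d d' > 0" using d' \<open>0 < d\<close> by simp
    then obtain a b where ab: "a \<le> t" "t \<le> b" "b - a < min d d'" "\<not> integral {a..b} f \<le> \<epsilon> * (b - a)"
      using t by blast
    have "a < b"
    proof (rule ccontr)
      assume "\<not> a < b"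
      then have "a = b" using ab by auto
      then show False using ab by auto
    qed
    moreover have "{a..b} \<subseteq> ball t d'"
      using ab by (auto simp: dist_real_def)
    ultimately have "(a,b) \<in> K" using d' ab by (auto simp: K_def)
    moreover have "t \<in> cball (c (a,b)) (r (a,b))" unfolding cb using ab by auto
    moreover have "r (a,b) < d" using ab \<open>a < b\<close> by (auto simp: r_def)
    ultimately show ?thesis by blast
  qed
  obtain C where C: "countable C" "C \<subseteq> K"
    and pw: "pairwise (\<lambda>i j. disjnt (cball (c i) (r i)) (cball (c j) (r j))) C"
    and neg: "negligible (?E - (\<Union>i\<in>C. cball (c i) (r i)))"
    by (rule Vitali_covering_theorem_cballs[OF rpos cover]) blast+
  let ?W = "\<Union>i\<in>C. cball (c i) (r i)"
  have bound: "measure lebesgue (\<Union>i\<in>J. cball (c i) (r i)) \<le> \<eta>" if J: "J \<subseteq> C" "finite J" for J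
  proof -
    let ?V = "\<Union>i\<in>J. cball (c i) (r i)"
    have Jpw: "pairwise (\<lambda>i j. disjnt (cball (c i) (r i)) (cball (c j) (r j))) J"
      using pw J(1) by (rule pairwise_subset)
    have "measure lebesgue ?V \<le> (\<Sum>i\<in>J. measure lebesgue (cball (c i) (r i)))"
      by (rule measure_UNION_le[OF J(2)]) auto
    also have "\<dots> \<le> (\<Sum>i\<in>J. integral (cball (c i) (r i)) f / \<epsilon>)"
    proof (rule sum_mono)
      fix i assume "i \<in> J"
      then have "i \<in> K" using J C by auto
      then show "measure lebesgue (cball (c i) (r i)) \<le> integral (cball (c i) (r i)) f / \<epsilon>"
        unfolding cb using \<open>\<epsilon> > 0\<close> by (auto simp: K_def field_simps)
    qed
    also have "\<dots> = (\<Sum>i\<in>J. integral (cball (c i) (r i)) f) / \<epsilon>"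
      by (simp add: sum_divide_distrib)
    also have "(\<Sum>i\<in>J. integral (cball (c i) (r i)) f) = integral ?V f"
    proof (rule integral_unique[symmetric, OF has_integral_UN[OF J(2)]])
      show "(f has_integral integral (cball (c i) (r i)) f) (cball (c i) (r i))" for i
        using fint by (intro integrable_integral) auto
      show "pairwise (\<lambda>i i'. negligible (cball (c i) (r i) \<inter> cball (c i') (r i'))) J"
        using Jpw by (auto simp: pairwise_def disjnt_def)
    qed
    also have "integral ?V f \<le> integral (U - Z) f"
    proof -
      have Vs: "?V \<in> sets lebesgue" using J(2) by (intro sets.finite_UN) auto
      have Us: "U \<in> sets lebesgue" using \<open>open U\<close> by simp
      have "?V \<subseteq> U" using J C unfolding cb by (fastforce simp: K_def)
      then have "integral ?V f \<le> integral U f"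
        by (intro integral_subset_le) (use fint Vs Us nonneg in auto)
      also have "integral U f = integral (U - Z) f"
      proof -
        have "integral U f = integral U (\<lambda>x. if x \<in> U - Z then f x else 0)"
          by (rule integral_cong) (auto simp: Z_def)
        also have "\<dots> = integral (U \<inter> (U - Z)) f"
          using integral_restrict_Int[of U "U - Z" f] by (simp add: Int_commute)
        also have "U \<inter> (U - Z) = U - Z" by auto
        finally show ?thesis .
      qed
      finally show ?thesis .
    qed
    also have "\<dots> \<le> \<epsilon> * \<eta>" using \<delta>(2)[OF U(3) _ mU] by simp
    finally show ?thesis using \<open>\<epsilon> > 0\<close> by (simp add: divide_right_mono field_simps)
  qed
  \<comment> \<open>A bound uniform over finite subfamilies passes to the countable union, and the
    selected intervals miss only a null part of the bad set.\<close>
  have Wm: "?W \<in> lmeasurable" and Wle: "measure lebesgue ?W \<le> \<eta>"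
    by (intro fmeasurable_UN_bound[OF C(1) _ bound] measure_UN_bound[OF C(1) _ bound]; simp)+
  let ?N = "?E - ?W"
  have "measure lebesgue (?N \<union> ?W) \<le> measure lebesgue ?N + measure lebesgue ?W"
    using neg Wm negligible_imp_measurable by (intro measure_Un_le) (auto simp: fmeasurable_def)
  also have "\<dots> \<le> \<eta>" using neg Wle by (simp add: negligible_imp_measure0)
  finally have "measure lebesgue (?N \<union> ?W) \<le> \<eta>" .
  moreover have "?N \<union> ?W \<in> lmeasurable"
    using neg Wm by (intro fmeasurable.Un) (auto simp: negligible_imp_measurable)
  ultimately show "\<exists>T. ?E \<subseteq> T \<and> T \<in> lmeasurable \<and> measure lebesgue T \<le> \<eta>"
    by (intro exI[of _ "?N \<union> ?W"]) auto
qed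

lemma absolutely_integrable_imp_integrable_subset:
  fixes f :: "'a::euclidean_space \<Rightarrow> 'b::euclidean_space"
  assumes "f absolutely_integrable_on S" "A \<in> sets lebesgue" "A \<subseteq> S"
  shows "f integrable_on A"
  using set_integrable_subset[OF assms] by (simp add: set_lebesgue_integral_eq_integral(1))

text \<open>The result on zeros is applied to truncated deviations of \<open>v\<close> from
  countably many constants. Outside the countable union of exceptional sets, the averages of
  \<open>norm (v s - v t)\<close> over short intervals around \<open>t\<close> are small, which is
  differentiability with derivative \<open>v t\<close>.\<close>

lemma negligible_not_differentiable_indefinite_integral:
  fixes v :: "real \<Rightarrow> 'a::euclidean_space"
  assumes v: "v absolutely_integrable_on {a..b}"
  shows "negligible {t \<in> {a..b}.
    \<not> ((\<lambda>s. integral {a..s} v) has_vector_derivative v t) (at t within {a..b})}"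
    (is "negligible ?E")
proof -
  obtain D :: "'a set" where D: "countable D" "UNIV \<subseteq> closure D"
    by (rule separable)
  \<comment> \<open>The constant \<open>c\<close> runs through a countable set and so cannot be
    \<open>v t\<close> itself. Subtracting \<open>1 / (k + 1)\<close> still makes the function
    vanish at \<open>t\<close> as soon as \<open>c\<close> is that close to
    \<open>v t\<close>.\<close>
  define f where "f = (\<lambda>c (k::nat) t. if t \<in> {a..b} then max 0 (norm (v t - c) - 1 / (real k + 1)) else 0)"
  define N where "N = (\<lambda>c k. {t. f c k t = 0 \<and>
      \<not> (\<exists>\<delta>>0. \<forall>p q. p \<le> t \<longrightarrow> t \<le> q \<longrightarrow> q - p < \<delta> \<longrightarrow> integral {p..q} (f c k) \<le> 1 / (real k + 1) * (q - p))})"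
  have vc: "(\<lambda>t. v t - c) absolutely_integrable_on {a..b}" for c
    by (rule set_integral_diff(1)[OF v]) (simp add: absolutely_integrable_on_const)
  have fai: "f c k absolutely_integrable_on UNIV" for c k
  proof -
    have "(\<lambda>t. max 0 (norm (v t - c) - 1 / (real k + 1))) absolutely_integrable_on {a..b}"
    proof (rule measurable_bounded_by_integrable_imp_absolutely_integrable)
      have "(\<lambda>t. v t - c) \<in> borel_measurable (lebesgue_on {a..b})"
        using absolutely_integrable_imp_borel_measurable[OF vc] by simp
      then show "(\<lambda>t. max 0 (norm (v t - c) - 1 / (real k + 1))) \<in> borel_measurable (lebesgue_on {a..b})"
        by measurable
      show "(\<lambda>t. norm (v t - c)) integrable_on {a..b}"
        using vc[of c] by (simp add: absolutely_integrable_on_def)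
    qed auto
    then show ?thesis
      unfolding f_def by (simp only: absolutely_integrable_restrict_UNIV)
  qed
  have N: "negligible (N c k)" for c k
    unfolding N_def
    by (rule negligible_zeros_with_large_averages[OF fai]) (auto simp: f_def)
  have "negligible (\<Union>((\<lambda>(c,k). N c k) ` (D \<times> UNIV)))"
    by (rule negligible_countable_Union) (use D N in auto)
  then show ?thesis
  proof (rule negligible_subset)
    show "?E \<subseteq> (\<Union>((\<lambda>(c,k). N c k) ` (D \<times> UNIV)))"
    proof (intro subsetI, rule ccontr)
      fix t assume tE: "t \<in> ?E" and notin: "t \<notin> (\<Union>((\<lambda>(c,k). N c k) ` (D \<times> UNIV)))"
      have t: "t \<in> {a..b}" using tE by simp
      have "((\<lambda>s. integral {a..s} v) has_vector_derivative v t) (at t within {a..b})"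
        unfolding has_vector_derivative_def has_derivative_within_alt
      proof (intro conjI allI impI)
        show "bounded_linear (\<lambda>x. x *\<^sub>R v t)" by (rule bounded_linear_scaleR_left)
        fix e :: real assume "e > 0"
        \<comment> \<open>The 3 anticipates three errors of size \<open>1 / (k + 1)\<close>: the
          average of \<open>f c k\<close>, its truncation level, and the distance from
          \<open>c\<close> to \<open>v t\<close>.\<close>
        obtain k :: nat where "3 / e < real k"
          using reals_Archimedean2 by blast
        then have k: "3 / (real k + 1) < e"
          using \<open>e > 0\<close> by (simp add: field_simps)
        define \<rho> where "\<rho> = 1 / (real k + 1)"
        have \<rho>: "\<rho> > 0" "3 * \<rho> < e" using k by (auto simp: \<rho>_def)
        obtain c where c: "c \<in> D" "dist c (v t) < \<rho>"
          using D(2) \<rho>(1) by (meson UNIV_I closure_approachable subsetD)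
        have "t \<notin> N c k" using notin c by auto
        moreover have "f c k t = 0" using c(2) by (auto simp: f_def \<rho>_def dist_norm norm_minus_commute)
        ultimately obtain \<delta> where \<delta>: "\<delta> > 0" and
          av: "\<And>p q. \<lbrakk>p \<le> t; t \<le> q; q - p < \<delta>\<rbrakk> \<Longrightarrow> integral {p..q} (f c k) \<le> \<rho> * (q - p)"
          unfolding N_def \<rho>_def by blast
        \<comment> \<open>An interval with \<open>t\<close> anywhere in it, endpoints included,
          serves the increments on both sides of \<open>t\<close>.\<close>
        have key: "norm (integral {p..q} v - (q - p) *\<^sub>R v t) \<le> e * (q - p)"
          if pq: "a \<le> p" "p \<le> t" "t \<le> q" "q \<le> b" "q - p < \<delta>" for p q
        proof -
          have vi: "v integrable_on {p..q}"
            by (rule absolutely_integrable_imp_integrable_subset[OF v]) (use pq in auto)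
          have fi: "f c k integrable_on {p..q}"
            by (rule absolutely_integrable_imp_integrable_subset[OF fai]) auto
          have "integral {p..q} v - (q - p) *\<^sub>R v t = integral {p..q} (\<lambda>s. v s - v t)"
            using pq vi by (subst integral_diff) auto
          also have "norm \<dots> \<le> integral {p..q} (\<lambda>s. f c k s + 2 * \<rho>)"
          proof (rule integral_norm_bound_integral)
            show "(\<lambda>s. v s - v t) integrable_on {p..q}" "(\<lambda>s. f c k s + 2 * \<rho>) integrable_on {p..q}"
              using vi fi by (auto intro: integrable_diff integrable_add)
            fix s assume "s \<in> {p..q}"
            then have "s \<in> {a..b}" using pq by auto
            then have "f c k s \<ge> norm (v s - c) - \<rho>" by (auto simp: f_def \<rho>_def)
            moreover have "norm (v s - v t) \<le> norm (v s - c) + norm (c - v t)"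
              using norm_triangle_ineq[of "v s - c" "c - v t"] by simp
            ultimately show "norm (v s - v t) \<le> f c k s + 2 * \<rho>"
              using c(2) by (simp add: dist_norm)
          qed
          also have "\<dots> = integral {p..q} (f c k) + 2 * \<rho> * (q - p)"
            using fi pq by (subst integral_add) auto
          also have "\<dots> \<le> 3 * \<rho> * (q - p)" using av[of p q] pq by (simp add: algebra_simps)
          also have "\<dots> \<le> e * (q - p)" using \<rho> pq by (intro mult_right_mono) auto
          finally show ?thesis .
        qed
        have vab: "v integrable_on {a..y}" if "y \<le> b" for y
          by (rule absolutely_integrable_imp_integrable_subset[OF v]) (use that in auto)
        show "\<exists>d>0. \<forall>y\<in>{a..b}. norm (y - t) < d \<longrightarrow>
            norm (integral {a..y} v - integral {a..t} v - (y - t) *\<^sub>R v t) \<le> e * norm (y - t)"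
        proof (intro exI[of _ \<delta>] conjI \<delta> ballI impI)
          fix y assume y: "y \<in> {a..b}" "norm (y - t) < \<delta>"
          show "norm (integral {a..y} v - integral {a..t} v - (y - t) *\<^sub>R v t) \<le> e * norm (y - t)"
          proof (cases "t \<le> y")
            case True
            have "integral {a..t} v + integral {t..y} v = integral {a..y} v"
              by (rule Henstock_Kurzweil_Integration.integral_combine) (use t y True vab in auto)
            then have "integral {a..y} v - integral {a..t} v = integral {t..y} v" by (simp add: algebra_simps)
            then show ?thesis using key[of t y] t y True by simp
          next
            case False
            have "integral {a..y} v + integral {y..t} v = integral {a..t} v"
              by (rule Henstock_Kurzweil_Integration.integral_combine) (use t y False vab in auto)
            then have "integral {a..y} v - integral {a..t} v - (y - t) *\<^sub>R v t
                = - (integral {y..t} v - (t - y) *\<^sub>R v t)" by (simp add: algebra_simps)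
            then show ?thesis using key[of y t] t y False by (simp only: norm_minus_cancel) auto
          qed
        qed
      qed
      then show False using tE by blast
    qed
  qed
qed

text \<open>The increments over nonoverlapping intervals add up to at most the integral of
  \<open>norm (v t)\<close> over their union, a set of measure below \<open>\<delta>\<close>.
  Passing to open intervals matches the form in which disjointness is given.\<close>

lemma absolutely_continuous_on_indefinite_integral:
  fixes v :: "real \<Rightarrow> 'a::euclidean_space"
  assumes v: "v absolutely_integrable_on {a..b}"
    and x: "\<And>t. t \<in> {a..b} \<Longrightarrow> x t = c + integral {a..t} v"
  shows "absolutely_continuous_on {a..b} x"
  unfolding absolutely_continuous_on_def
proof (intro allI impI)
  fix \<epsilon> :: real assume "\<epsilon> > 0"
  have nv: "(\<lambda>t. norm (v t)) absolutely_integrable_on {a..b}"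
    using v by (rule absolutely_integrable_norm[unfolded comp_def])
  obtain \<delta> where \<delta>: "\<delta> > 0"
    "\<And>A. \<lbrakk>A \<in> lmeasurable; A \<subseteq> {a..b}; measure lebesgue A < \<delta>\<rbrakk> \<Longrightarrow> integral A (\<lambda>t. norm (v t)) < \<epsilon>"
    by (rule integral_small_on_small_sets[OF nv _ _ \<open>\<epsilon> > 0\<close>]) auto
  show "\<exists>\<delta>>0. \<forall>(n::nat) a' b'. (\<forall>k<n. a' k \<le> b' k \<and> {a' k..b' k} \<subseteq> {a..b}) \<longrightarrow>
      disjoint_family_on (\<lambda>k. {a' k<..<b' k}) {..<n} \<longrightarrow> (\<Sum>k<n. b' k - a' k) < \<delta> \<longrightarrow>
      (\<Sum>k<n. dist (x (a' k)) (x (b' k))) < \<epsilon>"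
  proof (intro exI[of _ \<delta>] conjI \<delta> allI impI)
    fix n :: nat and p q :: "nat \<Rightarrow> real"
    assume pq: "\<forall>k<n. p k \<le> q k \<and> {p k..q k} \<subseteq> {a..b}"
      and disj: "disjoint_family_on (\<lambda>k. {p k<..<q k}) {..<n}"
      and small: "(\<Sum>k<n. q k - p k) < \<delta>"
    let ?A = "\<Union>k<n. {p k<..<q k}"
    have vi: "v integrable_on {s..t}" "(\<lambda>t. norm (v t)) integrable_on {s..t}" if "{s..t} \<subseteq> {a..b}" for s t
      using that by (auto intro: absolutely_integrable_imp_integrable_subset[OF v] absolutely_integrable_imp_integrable_subset[OF nv])
    have le: "dist (x (p k)) (x (q k)) \<le> integral {p k<..<q k} (\<lambda>t. norm (v t))" if "k < n" for k
    proof -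
      have k: "p k \<le> q k" "a \<le> p k" "q k \<le> b" "{p k..q k} \<subseteq> {a..b}"
        using pq that by auto
      have "integral {a..p k} v + integral {p k..q k} v = integral {a..q k} v"
        by (rule Henstock_Kurzweil_Integration.integral_combine) (use k vi[of a "q k"] in auto)
      then have "x (q k) - x (p k) = integral {p k..q k} v"
        using x[of "p k"] x[of "q k"] k by (simp add: algebra_simps)
      then have "dist (x (p k)) (x (q k)) = norm (integral {p k..q k} v)"
        by (metis dist_commute dist_norm)
      also have "\<dots> \<le> integral {p k..q k} (\<lambda>t. norm (v t))"
        by (rule integral_norm_bound_integral) (use vi k in auto)
      also have "\<dots> = integral {p k<..<q k} (\<lambda>t. norm (v t))"
        by (simp add: integral_open_interval_real)
      finally show ?thesis .
    qed
    have "((\<lambda>t. norm (v t)) has_integral (\<Sum>k<n. integral {p k<..<q k} (\<lambda>t. norm (v t)))) ?A"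
    proof (rule has_integral_UN)
      show "((\<lambda>t. norm (v t)) has_integral integral {p k<..<q k} (\<lambda>t. norm (v t))) {p k<..<q k}" if "k \<in> {..<n}" for k
        using vi(2)[of "p k" "q k"] pq that integrable_on_Icc_iff_Ioo by (intro integrable_integral) (auto)
      show "pairwise (\<lambda>i j. negligible ({p i<..<q i} \<inter> {p j<..<q j})) {..<n}"
        using disj by (auto simp: pairwise_def disjoint_family_on_def)
    qed auto
    then have "(\<Sum>k<n. integral {p k<..<q k} (\<lambda>t. norm (v t))) = integral ?A (\<lambda>t. norm (v t))"
      by (simp add: integral_unique)
    also have "\<dots> < \<epsilon>"
    proof (rule \<delta>(2))
      show "?A \<in> lmeasurable" by (intro fmeasurable.finite_UN) auto
      show "?A \<subseteq> {a..b}" using pq by fastforce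
      have "measure lebesgue ?A \<le> (\<Sum>k<n. measure lebesgue {p k<..<q k})"
        by (rule measure_UNION_le) auto
      also have "\<dots> = (\<Sum>k<n. q k - p k)" using pq by (intro sum.cong) auto
      finally show "measure lebesgue ?A < \<delta>" using small by simp
    qed
    finally show "(\<Sum>k<n. dist (x (p k)) (x (q k))) < \<epsilon>"
      using sum_mono[of "{..<n}" "\<lambda>k. dist (x (p k)) (x (q k))", OF le] by (simp add: le_less_trans)
  qed
qed

section \<open>Almost everywhere convergent convex combinations\<close>

text \<open>Dyadic convex combinations of the tail from index \<open>n\<close> on. Midpoints are all
  that the parallelogram law asks for, and the inductive form proves measurability, bounds and
  integral estimates without handling coefficients.\<close>

inductive_set midpoint_hull :: "(nat \<Rightarrow> 'b \<Rightarrow> 'a::real_vector) \<Rightarrow> nat \<Rightarrow> ('b \<Rightarrow> 'a) set"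
  for v :: "nat \<Rightarrow> 'b \<Rightarrow> 'a" and n :: nat where
  base: "n \<le> k \<Longrightarrow> v k \<in> midpoint_hull v n"
| midpoint: "\<lbrakk>w \<in> midpoint_hull v n; w' \<in> midpoint_hull v n\<rbrakk>
    \<Longrightarrow> (\<lambda>t. (1/2) *\<^sub>R (w t + w' t)) \<in> midpoint_hull v n"

lemma midpoint_hull_antimono:
  "w \<in> midpoint_hull v n \<Longrightarrow> n' \<le> n \<Longrightarrow> w \<in> midpoint_hull v n'"
  by (induction rule: midpoint_hull.induct) (auto intro: midpoint_hull.intros)

lemma midpoint_hull_in_convex_set:
  assumes "w \<in> midpoint_hull v n" "convex C" "\<And>k. n \<le> k \<Longrightarrow> v k t \<in> C"
  shows "w t \<in> C"
  using assms(1)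
proof induction
  case (midpoint w w')
  then show ?case
    using convexD[OF assms(2), of "w t" "w' t" "1/2" "1/2"] by (simp add: scaleR_right_distrib)
qed (use assms in auto)

lemma midpoint_hull_measurable:
  fixes v :: "nat \<Rightarrow> 'b \<Rightarrow> 'a::euclidean_space"
  assumes "w \<in> midpoint_hull v n" "\<And>k. v k \<in> borel_measurable M"
  shows "w \<in> borel_measurable M"
  using assms(1)
proof induction
  case (midpoint w w')
  then show ?case by measurable
qed (use assms in auto)

lemma midpoint_hull_norm_le:
  fixes v :: "nat \<Rightarrow> 'b \<Rightarrow> 'a::real_normed_vector"
  assumes "w \<in> midpoint_hull v n" "\<And>k. norm (v k t) \<le> c"
  shows "norm (w t) \<le> c"
  using midpoint_hull_in_convex_set[OF assms(1), of "cball 0 c" t] assms(2) by simp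

text \<open>Having an integral over \<open>A\<close> in a fixed closed ball around \<open>L\<close>
  is a convex condition, so it survives midpoints. Thus limits of integrals along \<open>v\<close>
  are inherited by functions chosen from its tail hulls.\<close>

lemma midpoint_hull_integral_close:
  fixes v :: "nat \<Rightarrow> 'b \<Rightarrow> 'a::euclidean_space"
  assumes "w \<in> midpoint_hull v n"
    and v: "\<And>k. integrable M (v k)" and A: "A \<in> sets M"
    and L: "\<And>k. n \<le> k \<Longrightarrow> norm ((LINT t:A|M. v k t) - L) \<le> e"
  shows "integrable M w \<and> norm ((LINT t:A|M. w t) - L) \<le> e"
  using assms(1)
proof induction
  case (midpoint w w')
  have i: "set_integrable M A w" "set_integrable M A w'"
    using midpoint A unfolding set_integrable_def by (auto intro: integrable_mult_indicator)
  have "(LINT t:A|M. (1/2) *\<^sub>R (w t + w' t)) = (1/2) *\<^sub>R ((LINT t:A|M. w t) + (LINT t:A|M. w' t))"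
    using i by (simp add: set_integral_add)
  then have "(LINT t:A|M. (1/2) *\<^sub>R (w t + w' t)) - L
      = (1/2) *\<^sub>R ((LINT t:A|M. w t) - L) + (1/2) *\<^sub>R ((LINT t:A|M. w' t) - L)"
    by (simp add: algebra_simps flip: scaleR_add_left)
  also have "norm \<dots> \<le> (1/2) * norm ((LINT t:A|M. w t) - L) + (1/2) * norm ((LINT t:A|M. w' t) - L)"
    by (rule norm_triangle_le) simp
  also have "\<dots> \<le> e" using midpoint by simp
  finally show ?case using midpoint by simp
qed (use assms in auto)

lemma midpoint_parallelogram:
  fixes a b :: "'a::real_inner"
  shows "(norm (a - b))\<^sup>2 = 2 * (norm a)\<^sup>2 + 2 * (norm b)\<^sup>2 - 4 * (norm ((1/2) *\<^sub>R (a + b)))\<^sup>2"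
  by (simp add: power2_norm_eq_inner inner_diff inner_add algebra_simps inner_commute)

text \<open>
  Minimise the strictly convex functional \<open>w \<mapsto> LINT t|M. (norm (w t))\<^sup>2 / (1 + m t)\<close> over the
  shrinking hulls of the tails: by the parallelogram law near-minimisers form a Cauchy sequence
  for this weighted distance. This replaces weak compactness and Mazur's lemma.
\<close>

lemma (in finite_measure) convex_combinations_converge_AE:
  fixes v :: "nat \<Rightarrow> 'a \<Rightarrow> 'b::euclidean_space"
  assumes v: "\<And>k. v k \<in> borel_measurable M" and m: "integrable M m"
    and le: "\<And>k t. t \<in> space M \<Longrightarrow> norm (v k t) \<le> m t"
  obtains u w where "\<And>j. u j \<in> midpoint_hull v j" "w \<in> borel_measurable M"
    "AE t in M. (\<lambda>j. u j t) \<longlonglongrightarrow> w t"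
proof -
  have m0: "0 \<le> m t" if "t \<in> space M" for t
    using le[OF that, of 0] norm_ge_zero order_trans by blast
  \<comment> \<open>The bound \<open>m\<close> is merely integrable, so
    \<open>(norm (w t))\<^sup>2\<close> may not be; after division by \<open>1 + m t\<close> it is
    dominated by \<open>m t\<close>.\<close>
  define \<Phi> where "\<Phi> = (\<lambda>w::'a \<Rightarrow> 'b. LINT t|M. (norm (w t))\<^sup>2 / (1 + m t))"
  have H_meas: "w \<in> borel_measurable M" if "w \<in> midpoint_hull v n" for w n
    using midpoint_hull_measurable[OF that v] .
  have H_le: "norm (w t) \<le> m t" if "w \<in> midpoint_hull v n" "t \<in> space M" for w n t
    using midpoint_hull_norm_le[OF that(1) le[OF that(2)]] .
  have sq_le: "x\<^sup>2 / (1 + y) \<le> y" if "0 \<le> x" "x \<le> y" for x y :: real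
  proof -
    have "x\<^sup>2 \<le> y\<^sup>2" using that by (intro power_mono)
    also have "\<dots> \<le> y * (1 + y)" using that by (simp add: power2_eq_square algebra_simps)
    finally show ?thesis using that by (simp add: divide_le_eq)
  qed
  have int: "integrable M (\<lambda>t. (norm (w t))\<^sup>2 / (1 + m t))" if "w \<in> midpoint_hull v n" for w n
  proof (rule Bochner_Integration.integrable_bound[OF m])
    show "(\<lambda>t. (norm (w t))\<^sup>2 / (1 + m t)) \<in> borel_measurable M"
      using H_meas[OF that] m by measurable
    show "AE t in M. norm ((norm (w t))\<^sup>2 / (1 + m t)) \<le> norm (m t)"
      using sq_le H_le[OF that] m0 by (auto intro!: AE_I2)
  qed
  have \<Phi>_bounds: "0 \<le> \<Phi> w" "\<Phi> w \<le> (LINT t|M. m t)" if "w \<in> midpoint_hull v n" for w n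
  proof -
    show "0 \<le> \<Phi> w" unfolding \<Phi>_def using m0 by (intro integral_nonneg_AE AE_I2) auto
    show "\<Phi> w \<le> (LINT t|M. m t)" unfolding \<Phi>_def
      by (rule integral_mono[OF int[OF that] m]) (use sq_le H_le[OF that] in auto)
  qed
  define d where "d = (\<lambda>n. Inf (\<Phi> ` midpoint_hull v n))"
  have bdd: "bdd_below (\<Phi> ` midpoint_hull v n)" for n
    using \<Phi>_bounds by (intro bdd_belowI[of _ 0]) auto
  have ne: "midpoint_hull v n \<noteq> {}" for n
    using midpoint_hull.base[of n n v] by auto
  have d_le: "d n \<le> \<Phi> w" if "w \<in> midpoint_hull v n" for w n
    unfolding d_def using that bdd by (intro cInf_lower) auto
  \<comment> \<open>The hulls shrink with \<open>n\<close>, so their infima increase; bounded by the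
    integral of \<open>m\<close>, they converge to some \<open>D\<close>.\<close>
  have "incseq d"
  proof (rule incseq_SucI)
    show "d n \<le> d (Suc n)" for n
      unfolding d_def using ne bdd by (intro cInf_superset_mono image_mono) (auto intro: midpoint_hull_antimono)
  qed
  moreover have "d n \<le> (LINT t|M. m t)" for n
    using d_le[of "v n" n] \<Phi>_bounds[of "v n" n] midpoint_hull.base[of n n v] by auto
  ultimately obtain D where D: "d \<longlonglongrightarrow> D" "\<And>n. d n \<le> D"
    using incseq_convergent[of d "LINT t|M. m t"] by blast
  have "\<exists>w. w \<in> midpoint_hull v n \<and> \<Phi> w < d n + 1 / 2^n" for n
  proof -
    have "Inf (\<Phi> ` midpoint_hull v n) < d n + 1 / 2^n" by (simp add: d_def)
    then show ?thesis using cInf_lessD[of "\<Phi> ` midpoint_hull v n"] ne by blast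
  qed
  then obtain y where y: "\<And>n. y n \<in> midpoint_hull v n" "\<And>n. \<Phi> (y n) < d n + 1 / 2^n"
    by metis
  \<comment> \<open>Both near-minimisers have value at most \<open>D + 1 / 2^n\<close>, while their
    midpoint still lies in the hull at \<open>n\<close> and so has value at least
    \<open>d n\<close>.\<close>
  have parallelogram: "(LINT t|M. (norm (y i t - y j t))\<^sup>2 / (1 + m t)) \<le> 4 * (D - d n) + 4 / 2^n"
    if ij: "n \<le> i" "n \<le> j" for i j n
  proof -
    have yi: "y i \<in> midpoint_hull v n" "y j \<in> midpoint_hull v n"
      using y(1) ij midpoint_hull_antimono by blast+
    let ?z = "\<lambda>t. (1/2) *\<^sub>R (y i t + y j t)"
    have z: "?z \<in> midpoint_hull v n" using yi by (rule midpoint_hull.midpoint)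
    have "(LINT t|M. (norm (y i t - y j t))\<^sup>2 / (1 + m t))
        = (LINT t|M. 2 * ((norm (y i t))\<^sup>2 / (1 + m t)) + 2 * ((norm (y j t))\<^sup>2 / (1 + m t))
            - 4 * ((norm (?z t))\<^sup>2 / (1 + m t)))"
      by (intro Bochner_Integration.integral_cong refl)
         (simp only: midpoint_parallelogram add_divide_distrib diff_divide_distrib times_divide_eq_right)
    also have "\<dots> = 2 * \<Phi> (y i) + 2 * \<Phi> (y j) - 4 * \<Phi> ?z"
    proof -
      have "(LINT t|M. 2 * a t + 2 * b t - 4 * c t) = 2 * (LINT t|M. a t) + 2 * (LINT t|M. b t) - 4 * (LINT t|M. c t)"
        if "integrable M a" "integrable M b" "integrable M c" for a b c :: "'a \<Rightarrow> real"
        using that by simp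
      from this[OF int[OF yi(1)] int[OF yi(2)] int[OF z]] show ?thesis unfolding \<Phi>_def .
    qed
    also have "\<dots> \<le> 2 * (D + 1 / 2^n) + 2 * (D + 1 / 2^n) - 4 * d n"
    proof -
      have "\<Phi> (y k) \<le> D + 1 / 2^n" if "n \<le> k" for k
      proof -
        have "(1::real) / 2^k \<le> 1 / 2^n" using that by (intro divide_left_mono) auto
        then show ?thesis using y(2)[of k] D(2)[of k] by linarith
      qed
      then show ?thesis using ij d_le[OF z] by (intro diff_mono add_mono mult_left_mono) auto
    qed
    finally show ?thesis by simp
  qed
  have "(\<lambda>n. 4 * (D - d n) + 4 / 2^n) \<longlonglongrightarrow> 4 * (D - D) + 4 * 0"
  proof (intro tendsto_intros D)
    have "(\<lambda>n. (1/2::real) ^ n) \<longlonglongrightarrow> 0" by (rule LIMSEQ_realpow_zero) auto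
    then show "(\<lambda>n. 4 / 2^n :: real) \<longlonglongrightarrow> 4 * 0"
      using tendsto_mult_left[of "\<lambda>n. (1/2::real) ^ n" 0 sequentially 4] by (simp add: power_divide)
  qed
  then have lim0: "(\<lambda>n. 4 * (D - d n) + 4 / 2^n) \<longlonglongrightarrow> 0" by simp
  \<comment> \<open>A fast subsequence: squared weighted distances below \<open>1 / 4^j\<close> will
    give L1 distances of order \<open>1 / 2^j\<close>, which are summable.\<close>
  have "\<exists>n\<ge>j. 4 * (D - d n) + 4 / 2^n < 1 / 4^j" for j :: nat
  proof -
    have "\<forall>\<^sub>F n in sequentially. 4 * (D - d n) + 4 / 2^n < 1 / 4^j \<and> n \<ge> j"
      by (intro eventually_conj order_tendstoD(2)[OF lim0] eventually_ge_at_top) simp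
    then show ?thesis unfolding eventually_sequentially by blast
  qed
  then obtain s where s: "\<And>j. s j \<ge> j" "\<And>j. 4 * (D - d (s j)) + 4 / 2^(s j) < 1 / 4^j"
    by metis
  \<comment> \<open>\<open>s\<close> need not be monotone; with running maxima, both
    \<open>r j\<close> and \<open>r (Suc j)\<close> are at least \<open>s j\<close>.\<close>
  define r where "r = (\<lambda>j. Max (s ` {..j}))"
  have r_ge: "s i \<le> r j" if "i \<le> j" for i j
    unfolding r_def using that by (intro Max_ge) auto
  define u where "u = (\<lambda>j. y (r j))"
  have uH: "u j \<in> midpoint_hull v j" for j
    unfolding u_def using y(1) midpoint_hull_antimono r_ge[of j j] s(1)[of j] order_trans by blast
  have close: "(LINT t|M. (norm (u j t - u (Suc j) t))\<^sup>2 / (1 + m t)) \<le> 1 / 4^j" for j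
    using parallelogram[of "s j" "r j" "r (Suc j)"] r_ge[of j j] r_ge[of j "Suc j"] s(2)[of j]
    unfolding u_def by simp
  have [measurable]: "u j \<in> borel_measurable M" for j using H_meas[OF uH] .
  have m_meas[measurable]: "m \<in> borel_measurable M" using m by simp
  have dint: "integrable M (\<lambda>t. (norm (u j t - u (Suc j) t))\<^sup>2 / (1 + m t))" for j
  proof (rule Bochner_Integration.integrable_bound[of M "\<lambda>t. 4 * m t"])
    show "integrable M (\<lambda>t. 4 * m t)" using m by simp
    show "AE t in M. norm ((norm (u j t - u (Suc j) t))\<^sup>2 / (1 + m t)) \<le> norm (4 * m t)"
    proof (rule AE_I2)
      fix t assume t: "t \<in> space M"
      have "norm (u j t - u (Suc j) t) \<le> 2 * m t"
        using norm_triangle_ineq4[of "u j t" "u (Suc j) t"] H_le[OF uH t, of j] H_le[OF uH t, of "Suc j"] by linarith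
      then have "(norm (u j t - u (Suc j) t) / 2)\<^sup>2 / (1 + m t) \<le> m t"
        by (intro sq_le) auto
      then show "norm ((norm (u j t - u (Suc j) t))\<^sup>2 / (1 + m t)) \<le> norm (4 * m t)"
        using m0[OF t] by (simp add: power_divide field_simps)
    qed
  qed measurable
  \<comment> \<open>The summand 1 absorbs \<open>2^j * (1 / 4^j)\<close>, and the integral comes
    from the second term of \<open>amgm\<close> below.\<close>
  define c where "c = 1 + (LINT t|M. 1 + m t)"
  have mint1: "integrable M (\<lambda>t. 1 + m t)" using m by simp
  \<comment> \<open>In place of the Cauchy-Schwarz inequality: with \<open>y = 1 + m t\<close> this
    turns the weighted quadratic estimate into an L1 estimate at the rate
    \<open>1 / 2^j\<close>.\<close>
  have amgm: "x \<le> 2^j * (x\<^sup>2 / y) + y / 2^j" if "y > 0" for x y :: real and j :: nat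
  proof -
    have "2^j * (x * y) = (2^j * x)\<^sup>2 + y\<^sup>2 / 4 - (2^j * x - y / 2)\<^sup>2"
      by (simp add: power2_eq_square algebra_simps)
    then have "2^j * (x * y) \<le> (2^j * x)\<^sup>2 + y\<^sup>2"
      using zero_le_power2[of "2^j * x - y / 2"] zero_le_power2[of y] by linarith
    then show ?thesis using that by (simp add: field_simps power2_eq_square)
  qed
  have normint: "integrable M (\<lambda>t. norm (u j t - u (Suc j) t))" for j
  proof (rule Bochner_Integration.integrable_bound[of M "\<lambda>t. 2 * m t"])
    show "integrable M (\<lambda>t. 2 * m t)" using m by simp
    show "AE t in M. norm (norm (u j t - u (Suc j) t)) \<le> norm (2 * m t)"
    proof (rule AE_I2)
      fix t assume t: "t \<in> space M"
      show "norm (norm (u j t - u (Suc j) t)) \<le> norm (2 * m t)"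
        using norm_triangle_ineq4[of "u j t" "u (Suc j) t"] H_le[OF uH t, of j] H_le[OF uH t, of "Suc j"] by simp
    qed
  qed measurable
  have L1: "(LINT t|M. norm (u j t - u (Suc j) t)) \<le> c * (1/2)^j" for j
  proof -
    have "(LINT t|M. norm (u j t - u (Suc j) t))
       \<le> (LINT t|M. 2^j * ((norm (u j t - u (Suc j) t))\<^sup>2 / (1 + m t)) + (1 + m t) / 2^j)"
    proof (rule integral_mono[OF normint])
      show "integrable M (\<lambda>t. 2^j * ((norm (u j t - u (Suc j) t))\<^sup>2 / (1 + m t)) + (1 + m t) / 2^j)"
        using dint[of j] mint1 m by (intro Bochner_Integration.integrable_add integrable_mult_right integrable_divide) auto
      show "norm (u j t - u (Suc j) t) \<le> 2^j * ((norm (u j t - u (Suc j) t))\<^sup>2 / (1 + m t)) + (1 + m t) / 2^j"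
        if "t \<in> space M" for t
        using m0[OF that] by (intro amgm) auto
    qed
    also have "\<dots> = 2^j * (LINT t|M. (norm (u j t - u (Suc j) t))\<^sup>2 / (1 + m t)) + (LINT t|M. 1 + m t) / 2^j"
    proof -
      have "(LINT t|M. 2^j * a t + b t / 2^j) = 2^j * (LINT t|M. a t) + (LINT t|M. b t) / 2^j"
        if "integrable M a" "integrable M b" for a b :: "'a \<Rightarrow> real"
        using that by simp
      from this[OF dint mint1] show ?thesis .
    qed
    also have "\<dots> \<le> 2^j * (1 / 4^j) + (LINT t|M. 1 + m t) / 2^j"
      using close[of j] by (intro add_mono mult_left_mono) auto
    also have "2^j * (1 / 4^j) = (1 / 2^j :: real)"
      by (simp add: field_simps flip: power_mult_distrib)
    finally show ?thesis by (simp add: c_def field_simps power_divide)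
  qed
  \<comment> \<open>The integral of the series is at most a geometric sum, so the series is finite
    a.e.; telescoping then turns summable increments into convergence of
    \<open>u j t\<close>.\<close>
  have "AE t in M. summable (\<lambda>j. norm (u j t - u (Suc j) t))"
  proof -
    let ?g = "\<lambda>t. \<Sum>j. ennreal (norm (u j t - u (Suc j) t))"
    have "0 \<le> (LINT t|M. norm (u 0 t - u (Suc 0) t))" by (rule integral_nonneg_AE) simp
    also have "\<dots> \<le> c" using L1[of 0] by simp
    finally have "c \<ge> 0" .
    have "(\<integral>\<^sup>+t. ?g t \<partial>M) = (\<Sum>j. \<integral>\<^sup>+t. ennreal (norm (u j t - u (Suc j) t)) \<partial>M)"
      by (rule nn_integral_suminf) measurable
    also have "\<dots> = (\<Sum>j. ennreal (LINT t|M. norm (u j t - u (Suc j) t)))"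
      using normint by (simp add: nn_integral_eq_integral)
    also have "\<dots> \<le> (\<Sum>j. ennreal (c * (1/2)^j))"
      using L1 by (intro suminf_le ennreal_leI) auto
    also have "\<dots> = ennreal (\<Sum>j. c * (1/2)^j)"
      using \<open>c \<ge> 0\<close> by (intro suminf_ennreal2) (auto intro!: summable_mult summable_geometric)
    also have "\<dots> < \<infinity>" by simp
    finally have "AE t in M. ?g t \<noteq> \<infinity>"
      by (intro nn_integral_PInf_AE) auto
    then show ?thesis
      by eventually_elim (rule summable_suminf_not_top, auto)
  qed
  then have conv: "AE t in M. convergent (\<lambda>j. u j t)"
  proof eventually_elim
    case (elim t)
    then have "summable (\<lambda>j. u j t - u (Suc j) t)" by (rule summable_norm_cancel)
    then have "convergent (\<lambda>n. u 0 t - (\<Sum>j<n. u j t - u (Suc j) t))"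
      by (intro convergent_diff convergent_const) (simp add: summable_iff_convergent)
    then show ?case by (simp add: sum_lessThan_telescope'[of "\<lambda>j. u j t"])
  qed
  show thesis
  proof (rule that[of u "\<lambda>t. lim (\<lambda>j. u j t)"])
    show "(\<lambda>t. lim (\<lambda>j. u j t)) \<in> borel_measurable M" by measurable
    show "AE t in M. (\<lambda>j. u j t) \<longlonglongrightarrow> lim (\<lambda>j. u j t)"
      using conv by eventually_elim (simp add: convergent_LIMSEQ_iff)
  qed (rule uH)
qed

text \<open>The combinations \<open>u j\<close> lie in the tail hulls, which preserves pointwise
  membership and limits of integrals; dominated convergence hands both on to \<open>w\<close>. No
  weak convergence of \<open>v\<close> is claimed: the last conclusion concerns sets on which the
  integrals of \<open>v k\<close> are known to converge.\<close>

lemma (in finite_measure) weak_sequential_limit: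
  fixes v :: "nat \<Rightarrow> 'a \<Rightarrow> 'b::euclidean_space"
  assumes v: "\<And>k. v k \<in> borel_measurable M" and m: "integrable M m"
    and le: "\<And>k t. t \<in> space M \<Longrightarrow> norm (v k t) \<le> m t"
  obtains w where "integrable M w"
    "AE t in M. \<forall>n. w t \<in> closure (convex hull {v k t | k. k \<ge> n})"
    "\<And>A L. \<lbrakk>A \<in> sets M; (\<lambda>k. LINT t:A|M. v k t) \<longlonglongrightarrow> L\<rbrakk> \<Longrightarrow> (LINT t:A|M. w t) = L"
proof (rule convex_combinations_converge_AE[where v = v, OF v m le])
  fix u w
  assume u: "\<And>j. u j \<in> midpoint_hull v j" and w: "w \<in> borel_measurable M"
    and uw: "AE t in M. (\<lambda>j. u j t) \<longlonglongrightarrow> w t"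
  have um: "u j \<in> borel_measurable M" for j
    using midpoint_hull_measurable[OF u v] .
  have ule: "norm (u j t) \<le> m t" if "t \<in> space M" for j t
    using midpoint_hull_norm_le[OF u le[OF that]] .
  have vint: "integrable M (v k)" for k
    by (rule Bochner_Integration.integrable_bound[OF m v]) (auto intro!: AE_I2 order_trans[OF le abs_ge_self])
  show thesis
  proof (rule that[of w])
    show "integrable M w"
      by (rule integrable_dominated_convergence[OF w um m uw]) (use ule in auto)
    show "AE t in M. \<forall>n. w t \<in> closure (convex hull {v k t | k. k \<ge> n})"
      using uw
    proof eventually_elim
      case (elim t)
      show ?case
      proof
        fix n
        have "\<forall>\<^sub>F j in sequentially. u j t \<in> closure (convex hull {v k t | k. k \<ge> n})"
          using eventually_ge_at_top[of n]
        proof eventually_elim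
          case (elim j)
          have "u j t \<in> convex hull {v k t | k. k \<ge> n}"
            by (rule midpoint_hull_in_convex_set[OF midpoint_hull_antimono[OF u elim]])
               (auto intro: hull_inc)
          then show ?case using closure_subset by blast
        qed
        then show "w t \<in> closure (convex hull {v k t | k. k \<ge> n})"
          by (rule Lim_in_closed_set[OF closed_closure _ _ elim]) simp
      qed
    qed
    fix A L assume A: "A \<in> sets M" and L: "(\<lambda>k. LINT t:A|M. v k t) \<longlonglongrightarrow> L"
    have "(\<lambda>j. LINT t:A|M. u j t) \<longlonglongrightarrow> (LINT t:A|M. w t)"
      unfolding set_lebesgue_integral_def
    proof (rule integral_dominated_convergence[OF _ _ m])
      show "(\<lambda>t. indicat_real A t *\<^sub>R w t) \<in> borel_measurable M"
        "(\<lambda>t. indicat_real A t *\<^sub>R u j t) \<in> borel_measurable M" for j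
        using w um A by measurable
      show "AE t in M. (\<lambda>j. indicat_real A t *\<^sub>R u j t) \<longlonglongrightarrow> indicat_real A t *\<^sub>R w t"
        using uw by eventually_elim (intro tendsto_intros)
      show "AE t in M. norm (indicat_real A t *\<^sub>R u j t) \<le> m t" for j
        using ule le by (intro AE_I2) (auto simp: indicator_def intro: order_trans[OF norm_ge_zero])
    qed
    moreover have "(\<lambda>j. LINT t:A|M. u j t) \<longlonglongrightarrow> L"
    proof (rule LIMSEQ_I)
      fix e :: real assume "e > 0"
      then obtain n where n: "\<And>k. k \<ge> n \<Longrightarrow> norm ((LINT t:A|M. v k t) - L) < e/2"
        using LIMSEQ_D[OF L, of "e/2"] by auto
      have "norm ((LINT t:A|M. u j t) - L) < e" if "j \<ge> n" for j
      proof -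
        have "norm ((LINT t:A|M. u j t) - L) \<le> e/2"
          using midpoint_hull_integral_close[OF midpoint_hull_antimono[OF u that] vint A, of L "e/2"] n by force
        then show ?thesis using \<open>e > 0\<close> by simp
      qed
      then show "\<exists>n. \<forall>j\<ge>n. norm ((LINT t:A|M. u j t) - L) < e" by blast
    qed
    ultimately show "(LINT t:A|M. w t) = L" by (rule LIMSEQ_unique)
  qed
qed

section \<open>Measurable selections and partitions of unity\<close>

text \<open>For nonempty closed convex values the closest point is unique. This canonical choice is
  what lets measurability be tested by countably many balls.\<close>

definition min_norm_selection :: "(real \<Rightarrow> 'a::euclidean_space set) \<Rightarrow> real \<Rightarrow> 'a" where
  "min_norm_selection G t = closest_point (G t) 0"

text \<open>Measurability is given for inclusions in closed sets, whereas avoiding \<open>C\<close>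
  is inclusion in an open set. A compact value avoiding \<open>C\<close> keeps a positive distance
  from it, so the open condition becomes a countable union of closed ones.\<close>

lemma measurable_multimap_on_disjoint_closed:
  fixes G :: "real \<Rightarrow> 'a::heine_borel set"
  assumes G: "measurable_multimap_on I G" and compact: "\<And>t. t \<in> I \<Longrightarrow> compact (G t)" and C: "closed C"
  shows "{t \<in> I. G t \<inter> C = {}} \<in> sets lebesgue"
proof (cases "C = {}")
  \<comment> \<open>Treated apart because \<open>infdist\<close> to the empty set is 0 by
    convention, which would make every \<open>A n\<close> below empty.\<close>
  case True
  have "{t \<in> I. G t \<subseteq> UNIV} \<in> sets lebesgue"
    using G unfolding measurable_multimap_on_def by blast
  then show ?thesis using True by simp
next
  case False
  define A where "A = (\<lambda>n::nat. {y. infdist y C \<ge> 1 / (real n + 1)})"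
  have A: "closed (A n)" for n
    unfolding A_def by (intro closed_Collect_le continuous_intros)
  have "{t \<in> I. G t \<inter> C = {}} = (\<Union>n. {t \<in> I. G t \<subseteq> A n})"
  proof (intro equalityI subsetI)
    fix t assume t: "t \<in> {t \<in> I. G t \<inter> C = {}}"
    then have "compact (G t)" "G t \<inter> C = {}" using compact by auto
    then obtain d where d: "d > 0" "\<And>y c. \<lbrakk>y \<in> G t; c \<in> C\<rbrakk> \<Longrightarrow> d \<le> dist y c"
      using separate_compact_closed[OF _ C, of "G t"] by blast
    obtain n :: nat where "1 / d < real n" using reals_Archimedean2 by blast
    then have n: "1 / (real n + 1) \<le> d" using \<open>d > 0\<close> by (simp add: field_simps)
    have "d \<le> infdist y C" if "y \<in> G t" for y
      using False d(2)[OF that] by (simp add: infdist_def cINF_greatest)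
    then have "G t \<subseteq> A n" using n unfolding A_def by force
    then show "t \<in> (\<Union>n. {t \<in> I. G t \<subseteq> A n})" using t by auto
  next
    fix t assume "t \<in> (\<Union>n. {t \<in> I. G t \<subseteq> A n})"
    then obtain n where t: "t \<in> I" "G t \<subseteq> A n" by auto
    have "A n \<inter> C = {}"
    proof -
      have "infdist y C = 0" if "y \<in> C" for y using that by simp
      then show ?thesis unfolding A_def by force
    qed
    then show "t \<in> {t \<in> I. G t \<inter> C = {}}" using t by auto
  qed
  also have "\<dots> \<in> sets lebesgue"
    using G A unfolding measurable_multimap_on_def by (intro sets.countable_UN) auto
  finally show ?thesis .
qed

text \<open>
  The closest point to the origin lies in a closed set \<open>C\<close> iff every rational ball meeting
  \<open>G t\<close> also meets \<open>G t \<inter> C\<close>: the sets \<open>G t \<inter> C \<inter> cball 0 r\<close> are compact and nested.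
\<close>

lemma min_norm_selection_measurable:
  fixes F :: "real \<Rightarrow> 'a::euclidean_space set"
  assumes F: "measurable_multimap_on I F" and I: "I \<in> sets lebesgue"
    and val: "\<And>t. t \<in> I \<Longrightarrow> convex (F t) \<and> compact (F t)"
    and H: "closed H" "convex H" and ne: "\<And>t. t \<in> I \<Longrightarrow> F t \<inter> H \<noteq> {}"
  shows "min_norm_selection (\<lambda>t. F t \<inter> H) \<in> borel_measurable (lebesgue_on I)"
proof (rule measurableI)
  fix C :: "'a set" assume "C \<in> sets borel"
  let ?s = "min_norm_selection (\<lambda>t. F t \<inter> H)"
  have closed_case: "{t \<in> I. ?s t \<in> C} \<in> sets lebesgue" if C: "closed C" for C
  proof -
    let ?B = "\<lambda>r C t. F t \<inter> (H \<inter> C \<inter> cball 0 r)"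
    have meas: "{t \<in> I. ?B r C t = {}} \<in> sets lebesgue" if "closed C" for r C
      using F val H that by (intro measurable_multimap_on_disjoint_closed) auto
    have iff: "?s t \<in> C \<longleftrightarrow> (\<forall>r\<in>\<rat>. ?B r UNIV t = {} \<or> ?B r C t \<noteq> {})" if t: "t \<in> I" for t
    proof -
      have K: "compact (F t \<inter> H)" "convex (F t \<inter> H)" "F t \<inter> H \<noteq> {}"
        using val[OF t] H ne[OF t] by (auto intro: compact_Int_closed convex_Int)
      have s: "?s t \<in> F t \<inter> H" "\<And>y. y \<in> F t \<inter> H \<Longrightarrow> norm (?s t) \<le> norm y"
        using closest_point_exists[of "F t \<inter> H" 0] K
        by (auto simp: min_norm_selection_def compact_imp_closed)
      show ?thesis
      proof
        assume sC: "?s t \<in> C"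
        show "\<forall>r\<in>\<rat>. ?B r UNIV t = {} \<or> ?B r C t \<noteq> {}"
        proof
          fix r :: real
          show "?B r UNIV t = {} \<or> ?B r C t \<noteq> {}"
          proof (cases "?B r UNIV t = {}")
            case False
            then obtain y where "y \<in> F t" "y \<in> H" "norm y \<le> r" by auto
            then have "norm (?s t) \<le> r" using s(2)[of y] by simp
            then have "?s t \<in> ?B r C t" using s(1) sC by simp
            then show ?thesis by blast
          qed simp
        qed
      next
        assume *: "\<forall>r\<in>\<rat>. ?B r UNIV t = {} \<or> ?B r C t \<noteq> {}"
        have "F t \<inter> H \<inter> C \<noteq> {}"
        proof -
          obtain r where "r \<in> \<rat>" "norm (?s t) < r"
            using Rats_dense_in_real[of "norm (?s t)" "norm (?s t) + 1"] by auto
          then have "?s t \<in> ?B r UNIV t" using s(1) by simp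
          then have "?B r C t \<noteq> {}" using * \<open>r \<in> \<rat>\<close> by blast
          then show ?thesis by blast
        qed
        moreover have "closed (F t \<inter> H \<inter> C)"
          using K C by (auto intro: compact_imp_closed)
        \<comment> \<open>If the minimal norm over \<open>F t \<inter> H \<inter> C\<close> exceeded
          that of the selection, a ball of rational radius between the two would meet
          \<open>F t \<inter> H\<close> but not \<open>C\<close> within it. So \<open>z\<close> also
          minimises the norm over \<open>F t \<inter> H\<close>, and uniqueness gives
          \<open>z = ?s t\<close>.\<close>
        ultimately obtain z where z: "z \<in> F t \<inter> H \<inter> C" "\<And>y. y \<in> F t \<inter> H \<inter> C \<Longrightarrow> norm z \<le> norm y"
          using distance_attains_inf[of "F t \<inter> H \<inter> C" 0] by auto
        have "norm z \<le> norm (?s t)"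
        proof (rule ccontr)
          assume "\<not> norm z \<le> norm (?s t)"
          then obtain r where r: "r \<in> \<rat>" "norm (?s t) < r" "r < norm z"
            using Rats_dense_in_real[of "norm (?s t)" "norm z"] by auto
          then have "?s t \<in> ?B r UNIV t" using s(1) by simp
          then have "?B r C t \<noteq> {}" using * r(1) by blast
          then obtain y where "y \<in> F t" "y \<in> H" "y \<in> C" "norm y \<le> r" by auto
          then show False using z(2)[of y] r(3) by simp
        qed
        then have "z = ?s t"
          using K s z by (intro any_closest_point_unique[of "F t \<inter> H" z "?s t" 0])
            (auto simp: compact_imp_closed intro: order_trans[OF _ s(2)])
        then show "?s t \<in> C" using z by auto
      qed
    qed
    have "{t \<in> I. ?s t \<in> C} = I - (\<Union>r\<in>\<rat>. {t \<in> I. ?B r C t = {}} - {t \<in> I. ?B r UNIV t = {}})"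
      using iff by auto
    also have "\<dots> \<in> sets lebesgue"
      using meas[OF C] meas[of UNIV] I countable_rat by (intro sets.Diff sets.countable_UN') auto
    finally show ?thesis .
  qed
  have "?s \<in> borel_measurable (lebesgue_on I)"
  proof (rule borel_measurableI)
    fix S :: "'a set" assume "open S"
    then have "{t \<in> I. ?s t \<in> - S} \<in> sets lebesgue" by (intro closed_case) auto
    then have "I - {t \<in> I. ?s t \<in> - S} \<in> sets lebesgue" using I by auto
    moreover have "I - {t \<in> I. ?s t \<in> - S} = ?s -` S \<inter> space (lebesgue_on I)" by auto
    ultimately show "?s -` S \<inter> space (lebesgue_on I) \<in> sets (lebesgue_on I)"
      using I by (auto simp: sets_restrict_space_iff)
  qed
  then show "?s -` C \<inter> space (lebesgue_on I) \<in> sets (lebesgue_on I)"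
    using \<open>C \<in> sets borel\<close> by (rule measurable_sets)
qed simp

text \<open>
  The functions are precomposed with the projection onto \<open>D\<close>, so that they are defined and
  continuous on the whole space.
\<close>

lemma finite_partition_of_unity:
  fixes D :: "'a::euclidean_space set"
  assumes D: "compact D" "convex D" "D \<noteq> {}" and "e > 0"
  obtains Q and \<phi> :: "'a \<Rightarrow> 'a \<Rightarrow> real" where "finite Q" "Q \<subseteq> D"
    "\<And>q. continuous_on UNIV (\<phi> q)" "\<And>q x. 0 \<le> \<phi> q x" "\<And>x. (\<Sum>q\<in>Q. \<phi> q x) = 1"
    "\<And>q x. \<lbrakk>x \<in> D; \<phi> q x \<noteq> 0\<rbrakk> \<Longrightarrow> dist q x < e"
proof -
  obtain Q where Q: "Q \<subseteq> D" "finite Q" "D \<subseteq> (\<Union>q\<in>Q. ball q e)"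
    using compactE_image[OF D(1), of D "\<lambda>q. ball q e"] \<open>e > 0\<close> by force
  define \<pi> where "\<pi> = closest_point D"
  have \<pi>: "continuous_on UNIV \<pi>" "\<And>x. \<pi> x \<in> D" "\<And>x. x \<in> D \<Longrightarrow> \<pi> x = x"
    unfolding \<pi>_def using D
    by (auto intro!: continuous_on_closest_point closest_point_in_set closest_point_self compact_imp_closed)
  \<comment> \<open>Tent functions: \<open>\<psi> q\<close> is positive exactly where the projected
    point is within \<open>e\<close> of \<open>q\<close>. As projected points lie in
    \<open>D\<close>, the cover makes the sum positive everywhere.\<close>
  define \<psi> where "\<psi> = (\<lambda>q x. max 0 (e - dist q (\<pi> x)))"
  define \<phi> where "\<phi> = (\<lambda>q x. \<psi> q x / (\<Sum>q\<in>Q. \<psi> q x))"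
  have \<psi>0: "0 \<le> \<psi> q x" for q x by (simp add: \<psi>_def)
  have pos: "(\<Sum>q\<in>Q. \<psi> q x) > 0" for x
  proof -
    obtain q where q: "q \<in> Q" "dist q (\<pi> x) < e" using Q(3) \<pi>(2)[of x] by auto
    show ?thesis by (rule sum_pos2[OF Q(2) q(1)]) (use q \<psi>0 in \<open>auto simp: \<psi>_def\<close>)
  qed
  have cont: "continuous_on UNIV (\<psi> q)" for q
    unfolding \<psi>_def by (intro continuous_intros \<pi>)
  show thesis
  proof (rule that[of Q \<phi>])
    show "continuous_on UNIV (\<phi> q)" for q
      unfolding \<phi>_def using pos cont by (intro continuous_intros) (auto simp: less_imp_neq[symmetric])
    show "0 \<le> \<phi> q x" for q x unfolding \<phi>_def using \<psi>0 pos[of x] by (simp add: less_imp_le)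
    show "(\<Sum>q\<in>Q. \<phi> q x) = 1" for x
      unfolding \<phi>_def using pos[of x] by (simp flip: sum_divide_distrib)
    show "dist q x < e" if "x \<in> D" "\<phi> q x \<noteq> 0" for q x
      using that \<pi>(3) by (auto simp: \<phi>_def \<psi>_def max_def split: if_splits)
  qed (use Q in auto)
qed

section \<open>Euler polygons with a nonlocal initial condition\<close>

text \<open>Dominated convergence along sequences. It transports continuity in the initial value to
  the Euler nodes, then to the path, then to the mean of \<open>h\<close> along the path.\<close>

lemma continuous_on_integral_parameter:
  fixes f :: "'p::metric_space \<Rightarrow> 'b::euclidean_space \<Rightarrow> 'c::euclidean_space"
  assumes "\<And>p. p \<in> P \<Longrightarrow> f p integrable_on J" and "m integrable_on J"
    and "\<And>p t. \<lbrakk>p \<in> P; t \<in> J\<rbrakk> \<Longrightarrow> norm (f p t) \<le> m t"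
    and "\<And>t. t \<in> J \<Longrightarrow> continuous_on P (\<lambda>p. f p t)"
  shows "continuous_on P (\<lambda>p. integral J (f p))"
  unfolding continuous_on_sequentially
proof (intro allI ballI impI, elim conjE)
  fix p a assume a: "a \<in> P" "\<forall>n. p n \<in> P" "p \<longlonglongrightarrow> a"
  have "(\<lambda>n. integral J (f (p n))) \<longlonglongrightarrow> integral J (f a)"
  proof (rule dominated_convergence(2)[OF _ assms(2)])
    show "(\<lambda>n. f (p n) t) \<longlonglongrightarrow> f a t" if "t \<in> J" for t
      using assms(4)[OF that] a by (auto simp: continuous_on_sequentially comp_def)
  qed (use assms a in auto)
  then show "((\<lambda>p. integral J (f p)) \<circ> p) \<longlonglongrightarrow> integral J (f a)"
    by (simp add: comp_def)
qed

text \<open>The state is frozen during a step while the time variable is integrated, since the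
  fields are only measurable in time and single time samples carry no information.\<close>

primrec euler_node :: "(real \<Rightarrow> 'a::euclidean_space \<Rightarrow> 'a) \<Rightarrow> real \<Rightarrow> nat \<Rightarrow> 'a \<Rightarrow> 'a" where
  "euler_node f d 0 x = x"
| "euler_node f d (Suc j) x = euler_node f d j x +
     integral {real j * d..real (Suc j) * d} (\<lambda>t. f t (euler_node f d j x))"

text \<open>At the final time \<open>N * d\<close> the index is \<open>N\<close>, one beyond the
  last step; this affects a single instant.\<close>

definition euler_speed :: "(real \<Rightarrow> 'a::euclidean_space \<Rightarrow> 'a) \<Rightarrow> real \<Rightarrow> 'a \<Rightarrow> real \<Rightarrow> 'a" where
  "euler_speed f d x t = f t (euler_node f d (nat \<lfloor>t / d\<rfloor>) x)"

definition euler_path :: "(real \<Rightarrow> 'a::euclidean_space \<Rightarrow> 'a) \<Rightarrow> real \<Rightarrow> 'a \<Rightarrow> real \<Rightarrow> 'a" where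
  "euler_path f d x t = x + integral {0..t} (euler_speed f d x)"

text \<open>A bound independent of the state is available because the fields to be used average
  finitely many selections taken at points of a fixed ball.\<close>

locale caratheodory_field =
  fixes T :: real and f :: "real \<Rightarrow> 'a::euclidean_space \<Rightarrow> 'a" and m :: "real \<Rightarrow> real"
  assumes T_pos: "T > 0"
    and field_measurable: "\<And>x. (\<lambda>t. f t x) \<in> borel_measurable (lebesgue_on {0..T})"
    and field_continuous: "\<And>t. t \<in> {0..T} \<Longrightarrow> continuous_on UNIV (f t)"
    and m_integrable: "m integrable_on {0..T}"
    and field_bound: "\<And>t x. t \<in> {0..T} \<Longrightarrow> norm (f t x) \<le> m t"
begin

lemma m_nonneg: "t \<in> {0..T} \<Longrightarrow> 0 \<le> m t"
  using field_bound norm_ge_zero order_trans by blast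

lemma m_integrable_on: "\<lbrakk>0 \<le> s; t \<le> T\<rbrakk> \<Longrightarrow> m integrable_on {s..t}"
  by (rule integrable_subinterval_real[OF m_integrable]) auto

lemma integrable_on_of_bound:
  fixes v :: "real \<Rightarrow> 'b::euclidean_space"
  assumes "v \<in> borel_measurable (lebesgue_on {0..T})" "\<And>t. t \<in> {0..T} \<Longrightarrow> norm (v t) \<le> m t"
    and "0 \<le> s" "t \<le> T"
  shows "v integrable_on {s..t}"
proof -
  have "v absolutely_integrable_on {0..T}"
    by (rule measurable_bounded_by_integrable_imp_absolutely_integrable[OF _ _ m_integrable])
       (use assms in auto)
  then show ?thesis
    by (rule absolutely_integrable_imp_integrable_subset) (use assms in auto)
qed

lemma field_integrable_on: "\<lbrakk>0 \<le> s; t \<le> T\<rbrakk> \<Longrightarrow> (\<lambda>\<tau>. f \<tau> x) integrable_on {s..t}"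
  by (rule integrable_on_of_bound[OF field_measurable field_bound])

lemma norm_integral_le:
  fixes v :: "real \<Rightarrow> 'b::euclidean_space"
  assumes "v \<in> borel_measurable (lebesgue_on {0..T})" "\<And>t. t \<in> {0..T} \<Longrightarrow> norm (v t) \<le> m t"
    and "0 \<le> s" "t \<le> T"
  shows "norm (integral {s..t} v) \<le> integral {s..t} m"
  by (rule integral_norm_bound_integral)
     (use assms m_integrable_on integrable_on_of_bound[OF assms] in auto)

section \<open>Euler polygons on a fixed grid\<close>

context
  fixes d :: real and N :: nat
  assumes d_pos: "d > 0" and steps: "real N * d = T"
begin

lemma grid_le: "j \<le> N \<Longrightarrow> real j * d \<le> T"
  using d_pos steps mult_right_mono[of "real j" "real N" d] by simp

lemma floor_le_steps: "t \<in> {0..T} \<Longrightarrow> nat \<lfloor>t / d\<rfloor> \<le> N"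
proof -
  assume "t \<in> {0..T}"
  then have "t / d \<le> real N" using steps d_pos by (simp add: divide_le_eq)
  then show ?thesis by linarith
qed

lemma continuous_on_euler_node: "j \<le> N \<Longrightarrow> continuous_on UNIV (euler_node f d j)"
proof (induction j)
  case (Suc j)
  have sub: "{real j * d..real (Suc j) * d} \<subseteq> {0..T}"
    using grid_le[OF Suc.prems] d_pos by auto
  have "continuous_on UNIV (\<lambda>x. integral {real j * d..real (Suc j) * d} (\<lambda>t. f t (euler_node f d j x)))"
  proof (rule continuous_on_integral_parameter)
    show "(\<lambda>t. f t (euler_node f d j x)) integrable_on {real j * d..real (Suc j) * d}" for x
      using d_pos grid_le[OF Suc.prems] by (intro field_integrable_on) auto
    show "m integrable_on {real j * d..real (Suc j) * d}"
      using d_pos grid_le[OF Suc.prems] by (intro m_integrable_on) auto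
    fix t assume "t \<in> {real j * d..real (Suc j) * d}"
    then have t: "t \<in> {0..T}" using sub by blast
    then show "norm (f t (euler_node f d j x)) \<le> m t" for x by (rule field_bound)
    show "continuous_on UNIV (\<lambda>x. f t (euler_node f d j x))"
      using continuous_on_compose2[OF field_continuous[OF t] Suc.IH] Suc.prems by simp
  qed
  then show ?case using Suc by (simp add: continuous_on_add del: of_nat_Suc)
qed simp

lemma euler_speed_measurable: "euler_speed f d x \<in> borel_measurable (lebesgue_on {0..T})"
  unfolding euler_speed_def
proof (rule measurable_compose_countable[OF field_measurable])
  have "(\<lambda>t::real. t) \<in> borel_measurable (lebesgue_on {0..T})"
    by (intro measurable_restrict_space1 measurable_completion) simp
  then show "(\<lambda>t. nat \<lfloor>t / d\<rfloor>) \<in> lebesgue_on {0..T} \<rightarrow>\<^sub>M count_space UNIV"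
    by measurable
qed

lemma euler_speed_bound: "t \<in> {0..T} \<Longrightarrow> norm (euler_speed f d x t) \<le> m t"
  unfolding euler_speed_def by (rule field_bound)

lemma continuous_on_euler_path:
  assumes t: "t \<in> {0..T}"
  shows "continuous_on UNIV (\<lambda>x. euler_path f d x t)"
proof -
  have "continuous_on UNIV (\<lambda>x. integral {0..t} (euler_speed f d x))"
  proof (rule continuous_on_integral_parameter)
    show "euler_speed f d x integrable_on {0..t}" for x
      by (rule integrable_on_of_bound[OF euler_speed_measurable euler_speed_bound]) (use t in auto)
    show "m integrable_on {0..t}" using t by (intro m_integrable_on) auto
    fix s assume s: "s \<in> {0..t}"
    then have s': "s \<in> {0..T}" using t by auto
    then show "norm (euler_speed f d x s) \<le> m s" for x by (rule euler_speed_bound)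
    show "continuous_on UNIV (\<lambda>x. euler_speed f d x s)"
      unfolding euler_speed_def
      by (rule continuous_on_compose2[OF field_continuous[OF s'] continuous_on_euler_node])
         (use floor_le_steps[OF s'] in auto)
  qed
  then show ?thesis unfolding euler_path_def by (intro continuous_intros)
qed

lemma euler_path_between_nodes:
  assumes j: "j < N" and t: "t \<in> {real j * d..real (Suc j) * d}"
    and node: "euler_path f d x (real j * d) = euler_node f d j x"
  shows "euler_path f d x t = euler_node f d j x +
    integral {real j * d..t} (\<lambda>s. f s (euler_node f d j x))"
proof -
  have le: "0 \<le> real j * d" "t \<le> T" using t grid_le[of "Suc j"] j d_pos by auto
  have "integral {0..real j * d} (euler_speed f d x) + integral {real j * d..t} (euler_speed f d x)
      = integral {0..t} (euler_speed f d x)"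
    by (rule Henstock_Kurzweil_Integration.integral_combine)
       (use t le integrable_on_of_bound[OF euler_speed_measurable euler_speed_bound] in auto)
  moreover have "integral {real j * d..t} (euler_speed f d x)
      = integral {real j * d..t} (\<lambda>s. f s (euler_node f d j x))"
  \<comment> \<open>The right endpoint is excluded because \<open>t\<close> may be the next node,
    where the index jumps to \<open>j + 1\<close>.\<close>
  proof (rule integral_spike[of "{t}"])
    fix s assume s: "s \<in> {real j * d..t} - {t}"
    then have "real j \<le> s / d" "s / d < real j + 1"
      using t d_pos by (auto simp: field_simps)
    then have "nat \<lfloor>s / d\<rfloor> = j" by linarith
    then show "f s (euler_node f d j x) = euler_speed f d x s" by (simp add: euler_speed_def)
  qed simp
  ultimately show ?thesis using node unfolding euler_path_def by (metis add.assoc)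
qed

lemma euler_path_node: "j \<le> N \<Longrightarrow> euler_path f d x (real j * d) = euler_node f d j x"
proof (induction j)
  case 0
  then show ?case by (simp add: euler_path_def)
next
  case (Suc j)
  then show ?case
    using euler_path_between_nodes[of j "real (Suc j) * d" x] d_pos by (simp add: distrib_right)
qed

lemma euler_path_decomp:
  assumes "t \<in> {0..T}"
  obtains j where "j \<le> N" "real j * d \<le> t" "t - real j * d \<le> d" "j = nat \<lfloor>t / d\<rfloor>"
    "euler_path f d x t = euler_node f d j x + integral {real j * d..t} (\<lambda>s. f s (euler_node f d j x))"
proof (cases "t = T")
  \<comment> \<open>At the final time the index is \<open>N\<close>, and the remaining integral is
    over a single point.\<close>
  case True
  have "t / d = real N" using True steps d_pos by (simp add: field_simps)
  then show thesis
    using True steps d_pos euler_path_node[of N x] by (intro that[of N]) auto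
next
  case False
  define j where "j = nat \<lfloor>t / d\<rfloor>"
  have "0 \<le> t / d" using assms d_pos by simp
  then have j: "real j \<le> t / d" "t / d < real j + 1" unfolding j_def by linarith+
  have "t / d < real N" using assms False steps d_pos by (simp add: field_simps)
  then have "j < N" using j by linarith
  moreover have t: "t \<in> {real j * d..real (Suc j) * d}"
    using j d_pos by (auto simp: field_simps)
  ultimately show thesis
    using euler_path_between_nodes[OF _ t euler_path_node, of x] j_def
    by (intro that[of j]) (auto simp: algebra_simps)
qed

section \<open>Almost invariance of a ball and the fixed point for the initial value\<close>

context
  fixes R e :: real
  assumes R: "R \<ge> 1" and e: "0 < e" "e \<le> 1" and small: "3 * e * integral {0..T} m \<le> 1"
    and modulus: "\<And>s t. \<lbrakk>0 \<le> s; s \<le> t; t \<le> T; t - s \<le> d\<rbrakk> \<Longrightarrow> integral {s..t} m \<le> e"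
    and inward: "\<And>t x. \<lbrakk>t \<in> {0..T}; R - 1 \<le> norm x; norm x \<le> R + 1\<rbrakk> \<Longrightarrow> x \<bullet> f t x \<le> e * m t"
begin

lemma integral_m_nonneg: "\<lbrakk>0 \<le> s; t \<le> T\<rbrakk> \<Longrightarrow> 0 \<le> integral {s..t} m"
  by (rule integral_nonneg[OF m_integrable_on]) (auto intro: m_nonneg)

lemma integral_m_mono: "t \<in> {0..T} \<Longrightarrow> integral {0..t} m \<le> integral {0..T} m"
  by (rule integral_subset_le) (auto intro: m_integrable_on m_nonneg)

text \<open>With \<open>k\<close> the total error, \<open>R \<ge> 1\<close> gives
  \<open>k \<le> 2 * R * k\<close>, so \<open>R\<^sup>2 + k\<close> is at most
  \<open>(R + k)\<^sup>2\<close>: the error in the squared norm is not magnified when passing to the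
  norm.\<close>

lemma bound_imp_le_Suc:
  assumes "t \<in> {0..T}" "(norm z)\<^sup>2 \<le> R\<^sup>2 + 3 * e * integral {0..t} m"
  shows "norm z \<le> R + 3 * e * integral {0..T} m" "norm z \<le> R + 1"
proof -
  define k where "k = 3 * e * integral {0..T} m"
  have k: "0 \<le> k" using e integral_m_nonneg[of 0 T] by (simp add: k_def)
  have "3 * e * integral {0..t} m \<le> k"
    unfolding k_def using integral_m_mono[OF assms(1)] e by simp
  also have "\<dots> \<le> 2 * R * k" using R k mult_right_mono[of 1 "2 * R" k] by simp
  finally have "(norm z)\<^sup>2 \<le> R\<^sup>2 + k\<^sup>2 + 2 * R * k"
    using assms(2) zero_le_power2[of k] by linarith
  then have "(norm z)\<^sup>2 \<le> (R + k)\<^sup>2" by (simp add: power2_sum)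
  then have le: "norm z \<le> R + k" using R k by (simp add: power2_le_iff_abs_le)
  then show "norm z \<le> R + 3 * e * integral {0..T} m" by (simp add: k_def)
  show "norm z \<le> R + 1" using le small by (simp add: k_def)
qed

text \<open>From norm below \<open>R - 1\<close> a step of length at most \<open>e \<le> 1\<close>
  cannot leave the ball. In the shell, the squared norm is expanded: with \<open>w\<close> the
  integral of \<open>m\<close> over the step, the inward condition bounds the cross term by
  \<open>2 * e * w\<close>, and the quadratic term is at most \<open>w * w \<le> e * w\<close>. This
  is the origin of the factor 3. Being additive in \<open>w\<close>, the errors sum to a total
  independent of the grid.\<close>

lemma euler_step_bound:
  assumes st: "0 \<le> s" "s \<le> t" "t \<le> T" "t - s \<le> d"
    and z: "(norm z)\<^sup>2 \<le> R\<^sup>2 + 3 * e * integral {0..s} m"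
  shows "(norm (z + integral {s..t} (\<lambda>\<tau>. f \<tau> z)))\<^sup>2 \<le> R\<^sup>2 + 3 * e * integral {0..t} m"
proof -
  let ?\<Delta> = "integral {s..t} (\<lambda>\<tau>. f \<tau> z)" and ?w = "integral {s..t} m"
  have w: "0 \<le> ?w" "?w \<le> e" using integral_m_nonneg modulus st by auto
  have \<Delta>: "norm ?\<Delta> \<le> ?w"
    by (rule norm_integral_le[OF field_measurable field_bound]) (use st in auto)
  have comb: "integral {0..s} m + ?w = integral {0..t} m"
    by (rule Henstock_Kurzweil_Integration.integral_combine) (use st m_integrable_on in auto)
  show ?thesis
  proof (cases "norm z < R - 1")
    case True
    have "norm (z + ?\<Delta>) \<le> R"
      using norm_triangle_ineq[of z ?\<Delta>] True \<Delta> w e by linarith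
    then have "(norm (z + ?\<Delta>))\<^sup>2 \<le> R\<^sup>2" by (intro power_mono) auto
    then show ?thesis using integral_m_nonneg[of 0 t] st e
      by (smt (verit) mult_nonneg_nonneg)
  next
    case False
    have zle: "norm z \<le> R + 1" using bound_imp_le_Suc(2)[OF _ z] st by simp
    have "z \<bullet> ?\<Delta> = integral {s..t} (\<lambda>\<tau>. z \<bullet> f \<tau> z)"
      using integral_linear[OF field_integrable_on bounded_linear_inner_right, of s t z z] st
      by (simp add: comp_def)
    also have "\<dots> \<le> integral {s..t} (\<lambda>\<tau>. e * m \<tau>)"
    proof (rule integral_le)
      show "(\<lambda>\<tau>. z \<bullet> f \<tau> z) integrable_on {s..t}"
        using integrable_linear[OF field_integrable_on bounded_linear_inner_right, of s t z z] st
        by (simp add: comp_def)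
      show "(\<lambda>\<tau>. e * m \<tau>) integrable_on {s..t}"
        using m_integrable_on st by (intro integrable_on_mult_right) auto
      show "z \<bullet> f \<tau> z \<le> e * m \<tau>" if "\<tau> \<in> {s..t}" for \<tau>
        by (rule inward) (use that st False zle in auto)
    qed
    finally have zd: "z \<bullet> ?\<Delta> \<le> e * ?w" by simp
    have "(norm ?\<Delta>)\<^sup>2 \<le> ?w * ?w" using mult_mono[OF \<Delta> \<Delta>] w by (simp add: power2_eq_square)
    also have "\<dots> \<le> e * ?w" using w by (intro mult_right_mono) auto
    finally have "(norm ?\<Delta>)\<^sup>2 \<le> e * ?w" .
    moreover have "(norm (z + ?\<Delta>))\<^sup>2 = (norm z)\<^sup>2 + 2 * (z \<bullet> ?\<Delta>) + (norm ?\<Delta>)\<^sup>2"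
      by (simp add: power2_norm_eq_inner inner_add inner_commute)
    ultimately have "(norm (z + ?\<Delta>))\<^sup>2 \<le> R\<^sup>2 + 3 * e * (integral {0..s} m + ?w)"
      using z zd by (simp add: algebra_simps)
    then show ?thesis using comb by simp
  qed
qed

lemma euler_node_bound:
  assumes "norm x \<le> R"
  shows "j \<le> N \<Longrightarrow> (norm (euler_node f d j x))\<^sup>2 \<le> R\<^sup>2 + 3 * e * integral {0..real j * d} m"
proof (induction j)
  case 0
  then show ?case using assms power_mono[of "norm x" R 2] by simp
next
  case (Suc j)
  show ?case unfolding euler_node.simps
    by (rule euler_step_bound) (use Suc grid_le[OF Suc.prems] d_pos in \<open>auto simp: distrib_right\<close>)
qed

lemma euler_path_bound:
  assumes x: "norm x \<le> R" and t: "t \<in> {0..T}"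
  shows "(norm (euler_path f d x t))\<^sup>2 \<le> R\<^sup>2 + 3 * e * integral {0..t} m"
proof -
  obtain j where j: "j \<le> N" "real j * d \<le> t" "t - real j * d \<le> d"
    "euler_path f d x t = euler_node f d j x + integral {real j * d..t} (\<lambda>s. f s (euler_node f d j x))"
    using euler_path_decomp[OF t] by blast
  show ?thesis unfolding j(4)
    by (rule euler_step_bound) (use j t d_pos euler_node_bound[OF x j(1)] in auto)
qed

lemma euler_path_continuous:
  "continuous_on {0..T} (euler_path f d x)"
  unfolding euler_path_def
  by (intro continuous_intros indefinite_integral_continuous_1
      integrable_on_of_bound[OF euler_speed_measurable euler_speed_bound]) auto

text \<open>As \<open>norm (h x) \<le> norm x\<close>, the mean of \<open>h\<close> along a polygon
  starting in the ball exceeds the radius by at most the total growth. Projecting the mean back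
  gives a continuous self-map of the ball, and the projection moves its argument by no more than
  that growth.\<close>

lemma euler_path_nonlocal:
  fixes h :: "'a \<Rightarrow> 'a"
  assumes h: "continuous_on UNIV h" "\<And>x. norm (h x) \<le> norm x"
  obtains x where "norm x \<le> R"
    "norm (x - (1 / T) *\<^sub>R integral {0..T} (\<lambda>t. h (euler_path f d x t))) \<le> 3 * e * integral {0..T} m"
proof -
  let ?k = "3 * e * integral {0..T} m"
  have k: "0 \<le> ?k" using e integral_m_nonneg[of 0 T] by simp
  define P where "P = (\<lambda>x. (1 / T) *\<^sub>R integral {0..T} (\<lambda>t. h (euler_path f d x t)))"
  have hle: "norm (h (euler_path f d x t)) \<le> R + ?k" if "norm x \<le> R" "t \<in> {0..T}" for x t
    using h(2) bound_imp_le_Suc(1)[OF that(2) euler_path_bound[OF that]] order_trans by blast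
  have hint: "(\<lambda>t. h (euler_path f d x t)) integrable_on {0..T}" for x
    by (intro integrable_continuous_real continuous_on_compose2[OF h(1) euler_path_continuous]) auto
  have "continuous_on (cball 0 R) (\<lambda>x. integral {0..T} (\<lambda>t. h (euler_path f d x t)))"
  proof (rule continuous_on_integral_parameter[where m = "\<lambda>_. R + ?k"])
    show "continuous_on (cball 0 R) (\<lambda>x. h (euler_path f d x t))" if "t \<in> {0..T}" for t
      by (rule continuous_on_subset[OF continuous_on_compose2[OF h(1) continuous_on_euler_path[OF that]]]) auto
    show "norm (h (euler_path f d x t)) \<le> R + ?k" if "x \<in> cball 0 R" "t \<in> {0..T}" for x t
      using that by (intro hle) auto
  qed (use hint in auto)
  then have P_cont: "continuous_on (cball 0 R) P"
    unfolding P_def by (intro continuous_intros)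
  have P_le: "norm (P x) \<le> R + ?k" if "norm x \<le> R" for x
  proof -
    have "norm (integral {0..T} (\<lambda>t. h (euler_path f d x t))) \<le> integral {0..T} (\<lambda>t. R + ?k)"
      by (rule integral_norm_bound_integral[OF hint]) (use hle[OF that] in auto)
    also have "\<dots> = T * (R + ?k)" using T_pos by simp
    finally show ?thesis using T_pos by (simp add: P_def divide_le_eq mult.commute)
  qed
  have ball: "closed (cball (0::'a) R)" "convex (cball (0::'a) R)" "cball (0::'a) R \<noteq> {}"
    using R by auto
  obtain x where x: "x \<in> cball 0 R" "(closest_point (cball 0 R) \<circ> P) x = x"
  proof (rule brouwer[of "cball (0::'a) R" "closest_point (cball 0 R) \<circ> P"])
    show "continuous_on (cball 0 R) (closest_point (cball 0 R) \<circ> P)"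
      using ball by (intro continuous_on_compose P_cont continuous_on_closest_point)
    show "closest_point (cball 0 R) \<circ> P \<in> cball 0 R \<rightarrow> cball 0 R"
      using closest_point_in_set[OF ball(1,3)] by (auto simp del: mem_cball)
  qed (use ball in auto)
  have "dist (P x) (closest_point (cball 0 R) (P x)) \<le> ?k"
  proof (cases "norm (P x) \<le> R")
    case True
    then show ?thesis using k by (simp add: closest_point_self)
  next
    case False
    \<comment> \<open>The radial point on the sphere is a competitor for the closest point, so the
      distance to the ball is at most \<open>norm (P x) - R\<close>.\<close>
    let ?w = "(R / norm (P x)) *\<^sub>R P x"
    have "P x \<noteq> 0" using False R by auto
    have "dist (P x) (closest_point (cball 0 R) (P x)) \<le> dist (P x) ?w"
      using False R by (intro closest_point_le ball) auto
    also have "dist (P x) ?w = norm ((1 - R / norm (P x)) *\<^sub>R P x)"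
      by (simp add: dist_norm scaleR_diff_left)
    also have "\<dots> = norm (P x) - R"
      using False \<open>P x \<noteq> 0\<close> by (simp add: abs_of_nonneg left_diff_distrib)
    also have "\<dots> \<le> ?k" using P_le[of x] x(1) by simp
    finally show ?thesis .
  qed
  then have "norm (x - P x) \<le> ?k" using x(2) by (simp add: dist_norm norm_minus_commute)
  then show thesis using x(1) unfolding P_def by (intro that[of x]) auto
qed

end
end

lemma approximate_nonlocal_solution:
  fixes h :: "'a \<Rightarrow> 'a"
  assumes h: "continuous_on UNIV h" "\<And>x. norm (h x) \<le> norm x"
    and R: "R \<ge> 1" and e: "0 < e" "e \<le> 1" and small: "3 * e * integral {0..T} m \<le> 1"
    and inward: "\<And>t x. \<lbrakk>t \<in> {0..T}; R - 1 \<le> norm x; norm x \<le> R + 1\<rbrakk> \<Longrightarrow> x \<bullet> f t x \<le> e * m t"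
  obtains v y where "v \<in> borel_measurable (lebesgue_on {0..T})"
    "\<And>t. t \<in> {0..T} \<Longrightarrow> norm (v t) \<le> m t"
    "\<And>t. t \<in> {0..T} \<Longrightarrow> y t = y 0 + integral {0..t} v"
    "\<And>t. t \<in> {0..T} \<Longrightarrow> norm (y t) \<le> R + 1"
    "norm (y 0 - (1 / T) *\<^sub>R integral {0..T} (\<lambda>t. h (y t))) \<le> 3 * e * integral {0..T} m"
    "\<And>t. t \<in> {0..T} \<Longrightarrow> \<exists>x. norm x \<le> R + 1 \<and> dist x (y t) \<le> e \<and> v t = f t x"
proof -
  have "uniformly_continuous_on {0..T} (\<lambda>t. integral {0..t} m)"
    by (intro compact_uniformly_continuous indefinite_integral_continuous_1 m_integrable) auto
  then obtain \<delta> where \<delta>: "\<delta> > 0"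
    "\<And>s t. \<lbrakk>s \<in> {0..T}; t \<in> {0..T}; dist t s < \<delta>\<rbrakk> \<Longrightarrow> dist (integral {0..t} m) (integral {0..s} m) < e"
    unfolding uniformly_continuous_on_def using e(1) by metis
  \<comment> \<open>The grid is made so fine that the primitive of \<open>m\<close> varies by less
    than \<open>e\<close> over one step.\<close>
  obtain N :: nat where N: "T / \<delta> < real N" using reals_Archimedean2 by blast
  have "0 < T / \<delta>" using T_pos \<delta> by simp
  then have N0: "real N > 0" using N by linarith
  define d where "d = T / real N"
  have d: "d > 0" "real N * d = T" "d < \<delta>"
    using N0 N T_pos \<delta>(1) by (auto simp: d_def field_simps)
  have modulus: "integral {s..t} m \<le> e" if st: "0 \<le> s" "s \<le> t" "t \<le> T" "t - s \<le> d" for s t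
  proof -
    have "integral {0..s} m + integral {s..t} m = integral {0..t} m"
      by (rule Henstock_Kurzweil_Integration.integral_combine) (use st m_integrable_on in auto)
    moreover have "dist (integral {0..t} m) (integral {0..s} m) < e"
      by (rule \<delta>(2)) (use st d in \<open>auto simp: dist_real_def\<close>)
    ultimately show ?thesis by (simp add: dist_real_def)
  qed
  note ctx = d(1,2) R e small modulus inward
  obtain x where x: "norm x \<le> R"
    "norm (x - (1 / T) *\<^sub>R integral {0..T} (\<lambda>t. h (euler_path f d x t))) \<le> 3 * e * integral {0..T} m"
    by (rule euler_path_nonlocal[OF ctx h])
  have y0: "euler_path f d x 0 = x" by (simp add: euler_path_def)
  show thesis
  proof (rule that[of "euler_speed f d x" "euler_path f d x"])
    show "euler_speed f d x \<in> borel_measurable (lebesgue_on {0..T})"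
      by (rule euler_speed_measurable[OF d(1,2)])
    fix t assume t: "t \<in> {0..T}"
    show "norm (euler_speed f d x t) \<le> m t" by (rule euler_speed_bound[OF d(1,2) t])
    show "euler_path f d x t = euler_path f d x 0 + integral {0..t} (euler_speed f d x)"
      by (simp add: euler_path_def)
    show "norm (euler_path f d x t) \<le> R + 1"
      by (rule bound_imp_le_Suc(2)[OF ctx t euler_path_bound[OF ctx x(1) t]])
    show "\<exists>z. norm z \<le> R + 1 \<and> dist z (euler_path f d x t) \<le> e \<and> euler_speed f d x t = f t z"
    proof (rule euler_path_decomp[OF d(1,2) t, of x])
      fix j assume j: "j \<le> N" "real j * d \<le> t" "t - real j * d \<le> d" "j = nat \<lfloor>t / d\<rfloor>"
        "euler_path f d x t = euler_node f d j x + integral {real j * d..t} (\<lambda>s. f s (euler_node f d j x))"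
      have jT: "real j * d \<in> {0..T}" using j t d by auto
      \<comment> \<open>The velocity at \<open>t\<close> is evaluated at the last node; the path has
        moved away from it by at most the integral of \<open>m\<close> over part of one
        step.\<close>
      have "norm (integral {real j * d..t} (\<lambda>s. f s (euler_node f d j x))) \<le> integral {real j * d..t} m"
        by (rule norm_integral_le[OF field_measurable field_bound]) (use t jT in auto)
      also have "\<dots> \<le> e" by (rule modulus) (use j(2,3) t jT in auto)
      finally have "dist (euler_node f d j x) (euler_path f d x t) \<le> e"
        unfolding j(5) by (simp add: dist_norm)
      moreover have "norm (euler_node f d j x) \<le> R + 1"
        by (rule bound_imp_le_Suc(2)[OF ctx jT euler_node_bound[OF ctx x(1) j(1)]])
      ultimately show ?thesis using j(4) by (auto simp: euler_speed_def)
    qed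
  qed (use x y0 in auto)
qed

end

section \<open>Guiding potentials and differential inclusions\<close>

text \<open>The point \<open>z\<close> in direction \<open>g\<close> with the norm of
  \<open>x\<close> is joined to \<open>x\<close> by a segment inside the ball of radius
  \<open>norm x\<close>, on which \<open>V\<close> is at most \<open>V x\<close>. Hence
  \<open>g \<bullet> (z - x) \<le> 0\<close>, which is equality in the Cauchy-Schwarz inequality for
  \<open>g\<close> and \<open>x\<close>.\<close>

lemma norm_monotone_gradient_radial:
  fixes V :: "'a::euclidean_space \<Rightarrow> real"
  assumes V: "norm_monotone V" and g: "GDERIV V x :> g" and "g \<noteq> 0"
  shows "norm g *\<^sub>R x = norm x *\<^sub>R g"
proof -
  define z where "z = (norm x / norm g) *\<^sub>R g"
  define u where "u = z - x"
  have nz: "norm z = norm x" using \<open>g \<noteq> 0\<close> by (simp add: z_def)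
  have "g \<bullet> u \<le> 0"
  proof (rule ccontr)
    assume "\<not> g \<bullet> u \<le> 0"
    then have pos: "0 < g \<bullet> u" by simp
    have "((\<lambda>s. x + s *\<^sub>R u) has_derivative (\<lambda>s. s *\<^sub>R u)) (at 0)"
      by (auto intro!: derivative_eq_intros)
    moreover have "(V has_derivative (\<lambda>h. h \<bullet> g)) (at (x + 0 *\<^sub>R u))"
      using g by (simp add: gderiv_def)
    ultimately have "((\<lambda>s. V (x + s *\<^sub>R u)) has_derivative (\<lambda>s. (s *\<^sub>R u) \<bullet> g)) (at 0)"
      by (rule has_derivative_compose)
    moreover have "(\<lambda>s. (s *\<^sub>R u) \<bullet> g) = (*) (g \<bullet> u)"
      by (auto simp: fun_eq_iff inner_commute)
    ultimately have "((\<lambda>s. V (x + s *\<^sub>R u)) has_real_derivative (g \<bullet> u)) (at 0)"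
      by (simp add: has_field_derivative_def)
    then obtain d where d: "d > 0" "\<And>h. \<lbrakk>0 < h; h < d\<rbrakk> \<Longrightarrow> V (x + 0 *\<^sub>R u) < V (x + (0 + h) *\<^sub>R u)"
      using DERIV_pos_inc_right[OF _ pos] by blast
    \<comment> \<open>\<open>d/2\<close> stays where a positive derivative forces \<open>V\<close>
      to be larger than at \<open>x\<close>; the cap at 1 stays on the segment, where
      \<open>V\<close> cannot be larger.\<close>
    define s where "s = min (d/2) 1"
    have s: "0 < s" "s < d" "s \<le> 1" using d(1) by (auto simp: s_def)
    have "x + s *\<^sub>R u = (1 - s) *\<^sub>R x + s *\<^sub>R z" by (simp add: u_def algebra_simps)
    also have "norm \<dots> \<le> (1 - s) * norm x + s * norm z"
      using s by (intro norm_triangle_le) simp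
    finally have "norm (x + s *\<^sub>R u) \<le> norm x" using nz by (simp add: algebra_simps)
    then have "V (x + s *\<^sub>R u) \<le> V x" using V by (simp add: norm_monotone_def)
    then show False using d(2)[OF s(1,2)] by simp
  qed
  then have "g \<bullet> z \<le> g \<bullet> x" by (simp add: u_def inner_diff_right)
  moreover have "g \<bullet> z = norm g * norm x"
    using \<open>g \<noteq> 0\<close> by (simp add: z_def power2_norm_eq_inner[symmetric] power2_eq_square)
  ultimately have "g \<bullet> x = norm g * norm x"
    using norm_cauchy_schwarz[of g x] by simp
  then show ?thesis using norm_cauchy_schwarz_eq[of g x] by simp
qed

lemma guiding_potential_imp_inward:
  fixes F :: "real \<Rightarrow> 'a::euclidean_space \<Rightarrow> 'a set"
  assumes V: "norm_monotone V" and guide: "weakly_negatively_guiding_potential I F V"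
  obtains R where "R > 0" "\<And>t x. \<lbrakk>t \<in> I; R \<le> norm x\<rbrakk> \<Longrightarrow> \<exists>y\<in>F t x. x \<bullet> y \<le> 0"
proof -
  obtain G R1 R2 where G: "\<And>x. GDERIV V x :> G x" and R1: "R1 > 0" "\<And>x::'a. R1 \<le> norm x \<Longrightarrow> G x \<noteq> 0"
    and R2: "R2 > 0" "\<And>x::'a. \<And>t. \<lbrakk>R2 \<le> norm x; t \<in> I\<rbrakk> \<Longrightarrow> \<exists>y\<in>F t x. G x \<bullet> y \<le> 0"
    using guide unfolding weakly_negatively_guiding_potential_def has_C1_gradient_def by metis
  show thesis
  proof (rule that[of "max R1 R2"])
    fix t and x :: 'a assume t: "t \<in> I" and x: "max R1 R2 \<le> norm x"
    obtain y where y: "y \<in> F t x" "G x \<bullet> y \<le> 0" using R2(2)[of x t] t x by auto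
    have g: "G x \<noteq> 0" using R1(2) x by simp
    have "norm (G x) * (x \<bullet> y) = norm x * (G x \<bullet> y)"
      using norm_monotone_gradient_radial[OF V G g] by (metis inner_scaleR_left)
    also have "\<dots> \<le> 0" using y(2) by (simp add: mult_nonneg_nonpos)
    finally have "x \<bullet> y \<le> 0" using g by (simp add: mult_le_0_iff)
    then show "\<exists>y\<in>F t x. x \<bullet> y \<le> 0" using y(1) by blast
  qed (use R1 in auto)
qed

text \<open>A closed convex neighbourhood of \<open>G x\<close> contains \<open>G q\<close> for all
  \<open>q\<close> near \<open>x\<close>, so it eventually contains every \<open>v k\<close>, and
  therefore the closed convex hull of a tail. As the neighbourhoods shrink to the closed set
  \<open>G x\<close>, so does the location of \<open>w\<close>.\<close>

lemma usc_multimap_convex_limit: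
  fixes G :: "'b::metric_space \<Rightarrow> 'a::euclidean_space set"
  assumes usc: "usc_multimap G" and K: "convex (G x)" "compact (G x)" "G x \<noteq> {}"
    and v: "\<And>k. v k \<in> convex hull (\<Union>q\<in>ball (y k) (\<epsilon> k). G q)"
    and y: "y \<longlonglongrightarrow> x" and \<epsilon>: "\<epsilon> \<longlonglongrightarrow> 0"
    and w: "\<And>n. w \<in> closure (convex hull {v k | k. n \<le> (k::nat)})"
  shows "w \<in> G x"
proof -
  have "infdist w (G x) \<le> \<eta>" if "\<eta> > 0" for \<eta>
  proof -
    \<comment> \<open>The Minkowski sum supplies closedness and convexity; the set \<open>U\<close>
      below is an open subset of it to which upper semicontinuity applies.\<close>
    define C where "C = (\<Union>a\<in>G x. \<Union>b\<in>cball 0 \<eta>. {a + b})"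
    have "convex C" unfolding C_def using K by (intro convex_sums) auto
    have "closed C" unfolding C_def using K by (intro compact_imp_closed compact_sums') auto
    define U where "U = {z. infdist z (G x) < \<eta>}"
    have "open U" unfolding U_def by (intro open_Collect_less continuous_intros)
    have UC: "U \<subseteq> C"
    proof
      fix z assume "z \<in> U"
      obtain a where a: "a \<in> G x" "infdist z (G x) = dist z a"
        using infdist_attains_inf[OF compact_imp_closed] K by blast
      have "z - a \<in> cball 0 \<eta>" using a(2) \<open>z \<in> U\<close> by (simp add: U_def dist_norm norm_minus_commute)
      then show "z \<in> C"
        unfolding C_def by (intro UN_I[OF a(1)] UN_I[of "z - a"]) auto
    qed
    have "open {q. G q \<subseteq> U}" using usc \<open>open U\<close> by (simp add: usc_multimap_def)
    moreover have "x \<in> {q. G q \<subseteq> U}" using \<open>\<eta> > 0\<close> by (auto simp: U_def)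
    ultimately obtain \<delta> where \<delta>: "\<delta> > 0" "ball x \<delta> \<subseteq> {q. G q \<subseteq> U}"
      using openE by blast
    have "\<forall>\<^sub>F k in sequentially. dist (y k) x < \<delta> / 2" "\<forall>\<^sub>F k in sequentially. \<epsilon> k < \<delta> / 2"
      using tendstoD[OF y, of "\<delta>/2"] order_tendstoD(2)[OF \<epsilon>, of "\<delta>/2"] \<delta>(1) by auto
    then have "\<forall>\<^sub>F k in sequentially. v k \<in> C"
    proof eventually_elim
      case (elim k)
      have "G q \<subseteq> C" if "q \<in> ball (y k) (\<epsilon> k)" for q
      proof -
        have "dist x q < \<delta>"
          using elim that dist_triangle[of x q "y k"] by (simp add: dist_commute)
        then have "G q \<subseteq> U" using \<delta>(2) by auto
        then show ?thesis using UC by blast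
      qed
      then have "(\<Union>q\<in>ball (y k) (\<epsilon> k). G q) \<subseteq> C" by (rule UN_least)
      then have "convex hull (\<Union>q\<in>ball (y k) (\<epsilon> k). G q) \<subseteq> C"
        using \<open>convex C\<close> by (rule hull_minimal)
      then show ?case using v by blast
    qed
    then obtain n where "\<And>k. n \<le> k \<Longrightarrow> v k \<in> C" by (auto simp: eventually_sequentially)
    then have "closure (convex hull {v k | k. n \<le> k}) \<subseteq> C"
      using \<open>convex C\<close> \<open>closed C\<close> by (intro closure_minimal hull_minimal) auto
    then obtain a b where "a \<in> G x" "norm b \<le> \<eta>" "w = a + b" using w[of n] unfolding C_def by auto
    then show ?thesis using infdist_le[of a "G x" w] by (simp add: dist_norm)
  qed
  then have "infdist w (G x) \<le> 0" by (rule field_le_epsilon[of _ 0, simplified]) 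
  then have "infdist w (G x) = 0" using infdist_nonneg[of w "G x"] by simp
  then show ?thesis using in_closed_iff_infdist_zero[of "G x" w] K by (simp add: compact_imp_closed)
qed

text \<open>
  The selections obey the inward condition at the grid points \<open>q\<close> only; moving it from \<open>q\<close> to a
  point \<open>x\<close> at distance less than \<open>e\<close> costs at most \<open>e * m t\<close>.
\<close>

lemma approximate_selection_exists:
  fixes F :: "real \<Rightarrow> 'a::euclidean_space \<Rightarrow> 'a set"
  assumes "T > 0"
    and val: "\<And>t x. t \<in> {0..T} \<Longrightarrow> F t x \<noteq> {} \<and> convex (F t x) \<and> compact (F t x)"
    and meas: "\<And>x. measurable_multimap_on {0..T} (\<lambda>t. F t x)"
    and m: "m integrable_on {0..T}"
    and bound: "\<And>t x y. \<lbrakk>t \<in> {0..T}; norm x \<le> R + 1; y \<in> F t x\<rbrakk> \<Longrightarrow> norm y \<le> m t"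
    and inward: "\<And>t x. \<lbrakk>t \<in> {0..T}; R - 2 \<le> norm x\<rbrakk> \<Longrightarrow> \<exists>y\<in>F t x. x \<bullet> y \<le> 0"
    and R: "R \<ge> 0" and e: "0 < e" "e \<le> 1"
  obtains f where "caratheodory_field T f m"
    "\<And>t x. \<lbrakk>t \<in> {0..T}; R - 1 \<le> norm x; norm x \<le> R + 1\<rbrakk> \<Longrightarrow> x \<bullet> f t x \<le> e * m t"
    "\<And>t x. \<lbrakk>t \<in> {0..T}; norm x \<le> R + 1\<rbrakk> \<Longrightarrow> f t x \<in> convex hull (\<Union>q\<in>ball x e. F t q)"
proof -
  \<comment> \<open>The half-space is demanded only where inward velocities are known to exist, so
    \<open>F t q \<inter> H q\<close> is never empty. The threshold \<open>R - 2\<close> leaves room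
    for grid points at distance below \<open>e \<le> 1\<close> from a point of norm at least
    \<open>R - 1\<close>.\<close>
  define H where "H = (\<lambda>q::'a. if R - 2 \<le> norm q then {y. q \<bullet> y \<le> 0} else UNIV)"
  have H: "closed (H q)" "convex (H q)" for q
    by (auto simp: H_def closed_halfspace_le convex_halfspace_le)
  define s where "s = (\<lambda>q. min_norm_selection (\<lambda>t. F t q \<inter> H q))"
  have ne: "F t q \<inter> H q \<noteq> {}" if "t \<in> {0..T}" for t q
    using inward[OF that, of q] val[OF that, of q] by (auto simp: H_def)
  have s_meas: "s q \<in> borel_measurable (lebesgue_on {0..T})" for q
    unfolding s_def by (rule min_norm_selection_measurable[OF meas _ _ H ne]) (use val in auto)
  have s_in: "s q t \<in> F t q" "s q t \<in> H q" if "t \<in> {0..T}" for q t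
  proof -
    have "closed (F t q \<inter> H q)" using val[OF that] H by (auto intro: compact_imp_closed)
    then have "s q t \<in> F t q \<inter> H q"
      unfolding s_def min_norm_selection_def by (rule closest_point_in_set[OF _ ne[OF that]])
    then show "s q t \<in> F t q" "s q t \<in> H q" by auto
  qed
  obtain Q and \<phi> :: "'a \<Rightarrow> 'a \<Rightarrow> real" where Q: "finite Q" "Q \<subseteq> cball 0 (R + 1)"
    and \<phi>: "\<And>q. continuous_on UNIV (\<phi> q)" "\<And>q x. 0 \<le> \<phi> q x" "\<And>x. (\<Sum>q\<in>Q. \<phi> q x) = 1"
      "\<And>q x. \<lbrakk>x \<in> cball 0 (R + 1); \<phi> q x \<noteq> 0\<rbrakk> \<Longrightarrow> dist q x < e"
    by (rule finite_partition_of_unity[of "cball (0::'a) (R + 1)" e]) (use R e in auto)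
  have s_le: "norm (s q t) \<le> m t" if "t \<in> {0..T}" "q \<in> Q" for q t
    using bound[OF that(1) _ s_in(1)[OF that(1)]] that(2) Q(2) by auto
  define f where "f = (\<lambda>t x. \<Sum>q\<in>Q. \<phi> q x *\<^sub>R s q t)"
  have f_le: "norm (f t x) \<le> m t" if t: "t \<in> {0..T}" for t x
  proof -
    have "norm (f t x) \<le> (\<Sum>q\<in>Q. \<phi> q x * m t)"
      unfolding f_def by (rule sum_norm_le) (use \<phi>(2) s_le[OF t] in \<open>auto intro: mult_left_mono\<close>)
    also have "\<dots> = m t" using \<phi>(3) by (simp flip: sum_distrib_right)
    finally show ?thesis .
  qed
  show thesis
  proof (rule that[of f])
    show "caratheodory_field T f m"
    proof
      show "(\<lambda>t. f t x) \<in> borel_measurable (lebesgue_on {0..T})" for x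
        unfolding f_def using s_meas by measurable
      show "continuous_on UNIV (f t)" for t
        unfolding f_def by (intro continuous_intros \<phi>(1))
    qed (use \<open>T > 0\<close> m f_le in auto)
    fix t and x :: 'a assume t: "t \<in> {0..T}" and x: "norm x \<le> R + 1"
    have near: "dist q x < e" if "\<phi> q x \<noteq> 0" for q using \<phi>(4)[OF _ that] x by simp
    let ?S = "\<Union>q\<in>ball x e. F t q"
    \<comment> \<open>A filler from the hull: at grid points with zero weight \<open>s q t\<close>
      may lie outside \<open>?S\<close>, so it is replaced there without changing the sum.\<close>
    define z where "z = s x t"
    have z: "z \<in> ?S" using s_in(1)[OF t, of x] e by (auto simp: z_def intro!: bexI[of _ x])
    have "f t x = (\<Sum>q\<in>Q. \<phi> q x *\<^sub>R (if \<phi> q x = 0 then z else s q t))"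
      unfolding f_def by (intro sum.cong) auto
    also have "\<dots> \<in> convex hull ?S"
    proof (rule convex_sum[OF Q(1) convex_convex_hull \<phi>(3,2)])
      fix q
      have "(if \<phi> q x = 0 then z else s q t) \<in> ?S"
        using z near[of q] s_in(1)[OF t, of q] by (auto simp: dist_commute)
      then show "(if \<phi> q x = 0 then z else s q t) \<in> convex hull ?S" by (rule hull_inc)
    qed
    finally show "f t x \<in> convex hull ?S" .
    assume x': "R - 1 \<le> norm x"
    have "x \<bullet> f t x = (\<Sum>q\<in>Q. \<phi> q x * (x \<bullet> s q t))"
      by (simp add: f_def inner_sum_right)
    also have "\<dots> \<le> (\<Sum>q\<in>Q. \<phi> q x * (e * m t))"
    proof (rule sum_mono)
      fix q assume q: "q \<in> Q"
      show "\<phi> q x * (x \<bullet> s q t) \<le> \<phi> q x * (e * m t)"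
      proof (cases "\<phi> q x = 0")
        case False
        have d: "norm (x - q) < e" using near[OF False] by (simp add: dist_norm norm_minus_commute)
        have "R - 2 \<le> norm q" using d e x' norm_triangle_ineq2[of x q] by linarith
        then have "q \<bullet> s q t \<le> 0" using s_in(2)[OF t, of q] by (simp add: H_def)
        then have "x \<bullet> s q t \<le> (x - q) \<bullet> s q t" by (simp add: inner_diff_left)
        also have "\<dots> \<le> norm (x - q) * norm (s q t)" by (rule norm_cauchy_schwarz)
        also have "\<dots> \<le> e * m t" using d e s_le[OF t q] by (intro mult_mono) auto
        finally show ?thesis using \<phi>(2) by (intro mult_left_mono) auto
      qed simp
    qed
    also have "\<dots> = e * m t" using \<phi>(3) by (simp flip: sum_distrib_right)
    finally show "x \<bullet> f t x \<le> e * m t" .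
  qed
qed

section \<open>Transfer between integrals and null sets on a subset\<close>

lemma set_lebesgue_integral_lebesgue_on:
  fixes w :: "'a::euclidean_space \<Rightarrow> 'b::euclidean_space"
  assumes w: "w absolutely_integrable_on S" and A: "A \<in> sets lebesgue" "A \<subseteq> S" and S: "S \<in> sets lebesgue"
  shows "(LINT t:A|lebesgue_on S. w t) = integral A w"
proof -
  have "(LINT t:A|lebesgue_on S. w t) = (LINT t|lebesgue. indicat_real S t *\<^sub>R indicat_real A t *\<^sub>R w t)"
    unfolding set_lebesgue_integral_def using S by (subst integral_restrict_space) auto
  also have "\<dots> = (LINT t:A|lebesgue. w t)"
    unfolding set_lebesgue_integral_def using A(2)
    by (intro Bochner_Integration.integral_cong) (auto simp: indicator_def)
  also have "\<dots> = integral A w"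
    using set_integrable_subset[OF w A] by (rule set_lebesgue_integral_eq_integral(2))
  finally show ?thesis .
qed

lemma integrable_lebesgue_on_iff:
  fixes w :: "'a::euclidean_space \<Rightarrow> 'b::euclidean_space"
  assumes "S \<in> sets lebesgue"
  shows "integrable (lebesgue_on S) w \<longleftrightarrow> w absolutely_integrable_on S"
  unfolding set_integrable_def using assms by (simp add: integrable_restrict_space)

lemma AE_lebesgue_on_notin_negligible:
  assumes "negligible {t \<in> S. \<not> P t}" "S \<in> sets lebesgue"
  shows "AE t in lebesgue_on S. P t"
proof -
  have "AE t in lebesgue. t \<in> S \<longrightarrow> P t"
    unfolding eventually_ae_filter_negligible using assms(1) by (intro exI[of _ "{t \<in> S. \<not> P t}"]) auto
  then show ?thesis using assms(2) by (subst AE_restrict_space_iff) auto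
qed

text \<open>The potential has been reduced to an inward condition outside a ball. What remains is to
  let the approximation parameter tend to 0, with all bounds independent of it.\<close>

lemma nonlocal_inclusion_solution:
  fixes h :: "'a::euclidean_space \<Rightarrow> 'a" and F :: "real \<Rightarrow> 'a \<Rightarrow> 'a set"
  assumes T: "T > 0"
    and h: "continuous_on UNIV h" "\<And>x. norm (h x) \<le> norm x"
    and F: "caratheodory_map {0..T} F"
    and R0: "R0 > 0" and inward: "\<And>t x. \<lbrakk>t \<in> {0..T}; R0 \<le> norm x\<rbrakk> \<Longrightarrow> \<exists>y\<in>F t x. x \<bullet> y \<le> 0"
  shows "\<exists>x. inclusion_solution_on {0..T} F x \<and>
           x 0 = (1 / T) *\<^sub>R integral {0..T} (\<lambda>t. h (x t))"
proof -
  have val: "\<And>t x. t \<in> {0..T} \<Longrightarrow> F t x \<noteq> {} \<and> convex (F t x) \<and> compact (F t x)"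
    and meas: "\<And>x. measurable_multimap_on {0..T} (\<lambda>t. F t x)"
    and usc: "AE t in lebesgue_on {0..T}. usc_multimap (F t)"
    using F unfolding caratheodory_map_def by auto
  obtain \<mu> :: "real \<Rightarrow> real" where \<mu>: "\<mu> absolutely_integrable_on {0..T}"
    "\<And>t x. t \<in> {0..T} \<Longrightarrow> (SUP y\<in>F t x. norm y) \<le> \<mu> t * (1 + norm x)"
    using F unfolding caratheodory_map_def by blast
  \<comment> \<open>The selections ask for inward velocities from norm \<open>R - 2\<close> on,
    which is \<open>R0\<close>; this also gives \<open>R \<ge> 1\<close>.\<close>
  define R where "R = R0 + 2"
  \<comment> \<open>All points in play have norm at most \<open>R + 1\<close>, so the linear growth
    factor \<open>1 + norm x\<close> is at most \<open>2 + R\<close>.\<close>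
  define m where "m = (\<lambda>t. (2 + R) * \<bar>\<mu> t\<bar>)"
  have m_ai: "m absolutely_integrable_on {0..T}"
    unfolding m_def using absolutely_integrable_norm[OF \<mu>(1)]
    by (intro set_integrable_mult_right) (simp add: comp_def)
  have m: "m integrable_on {0..T}" using m_ai by (simp add: set_lebesgue_integral_eq_integral(1))
  have bound: "norm y \<le> m t" if t: "t \<in> {0..T}" and x: "norm x \<le> R + 1" and y: "y \<in> F t x" for t x y
  proof -
    have "bdd_above (norm ` F t x)"
      using val[OF t, of x] by (intro bounded_imp_bdd_above compact_imp_bounded compact_continuous_image)
        (auto intro: continuous_intros)
    then have "norm y \<le> (SUP y\<in>F t x. norm y)" using y by (intro cSUP_upper)
    also have "\<dots> \<le> \<mu> t * (1 + norm x)" by (rule \<mu>(2)[OF t])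
    also have "\<dots> \<le> \<bar>\<mu> t\<bar> * (2 + R)" using x by (intro mult_mono) auto
    finally show ?thesis by (simp add: m_def mult.commute)
  qed
  have m0: "0 \<le> m t" for t using R0 by (simp add: m_def R_def)
  define M where "M = integral {0..T} m"
  have M0: "0 \<le> M" unfolding M_def by (rule integral_nonneg[OF m m0])
  \<comment> \<open>The factor \<open>1 + 3 * M\<close> ensures both \<open>e n \<le> 1\<close> and
    \<open>3 * e n * M \<le> 1\<close>, also when \<open>M = 0\<close>.\<close>
  define e where "e = (\<lambda>n::nat. 1 / ((1 + 3 * M) * (real n + 1)))"
  have e: "0 < e n" "e n \<le> 1" "3 * e n * M \<le> 1" for n
  proof -
    have *: "1 \<le> real n + 1" "1 \<le> 1 + 3 * M" using M0 by auto
    then have "1 * 1 \<le> (1 + 3 * M) * (real n + 1)" by (intro mult_mono) auto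
    then show "0 < e n" "e n \<le> 1" by (auto simp: e_def)
    have "(1 + 3 * M) * 1 \<le> (1 + 3 * M) * (real n + 1)" using * by (intro mult_left_mono) auto
    then have "3 * M \<le> (1 + 3 * M) * (real n + 1)" by simp
    then show "3 * e n * M \<le> 1" using * by (simp add: e_def divide_le_eq)
  qed
  have e_lim: "e \<longlonglongrightarrow> 0"
  proof -
    have "(\<lambda>n. (1 / (1 + 3 * M)) * inverse (real (Suc n))) \<longlonglongrightarrow> (1 / (1 + 3 * M)) * 0"
      by (intro tendsto_intros LIMSEQ_inverse_real_of_nat)
    then show ?thesis by (simp add: e_def[abs_def] field_simps)
  qed
  \<comment> \<open>The radius \<open>2 * e n\<close> adds two displacements: from the path to the
    Euler node, and from the node to the grid points where velocities are selected.\<close>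
  have "\<exists>v y. v \<in> borel_measurable (lebesgue_on {0..T}) \<and>
      (\<forall>t\<in>{0..T}. norm (v t) \<le> m t \<and> y t = y 0 + integral {0..t} v \<and> norm (y t) \<le> R + 1 \<and>
         v t \<in> convex hull (\<Union>q\<in>ball (y t) (2 * e n). F t q)) \<and>
      norm (y 0 - (1 / T) *\<^sub>R integral {0..T} (\<lambda>t. h (y t))) \<le> 3 * e n * M" for n
  proof (rule approximate_selection_exists[of T F m R "e n", OF T val meas m bound])
    fix f assume f: "caratheodory_field T f m"
      "\<And>t x. \<lbrakk>t \<in> {0..T}; R - 1 \<le> norm x; norm x \<le> R + 1\<rbrakk> \<Longrightarrow> x \<bullet> f t x \<le> e n * m t"
      "\<And>t x. \<lbrakk>t \<in> {0..T}; norm x \<le> R + 1\<rbrakk> \<Longrightarrow> f t x \<in> convex hull (\<Union>q\<in>ball x (e n). F t q)"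
    interpret caratheodory_field T f m by (rule f(1))
    have R1: "1 \<le> R" and small: "3 * e n * integral {0..T} m \<le> 1"
      using R0 e(3)[of n] by (auto simp: R_def M_def)
    show ?thesis
    proof (rule approximate_nonlocal_solution[of h R "e n", OF h R1 e(1,2) small f(2)])
      fix v y assume vy: "v \<in> borel_measurable (lebesgue_on {0..T})"
        "\<And>t. t \<in> {0..T} \<Longrightarrow> norm (v t) \<le> m t"
        "\<And>t. t \<in> {0..T} \<Longrightarrow> y t = y 0 + integral {0..t} v"
        "\<And>t. t \<in> {0..T} \<Longrightarrow> norm (y t) \<le> R + 1"
        "norm (y 0 - (1 / T) *\<^sub>R integral {0..T} (\<lambda>t. h (y t))) \<le> 3 * e n * integral {0..T} m"
        "\<And>t. t \<in> {0..T} \<Longrightarrow> \<exists>x. norm x \<le> R + 1 \<and> dist x (y t) \<le> e n \<and> v t = f t x"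
      have "v t \<in> convex hull (\<Union>q\<in>ball (y t) (2 * e n). F t q)" if t: "t \<in> {0..T}" for t
      proof -
        obtain x where x: "norm x \<le> R + 1" "dist x (y t) \<le> e n" "v t = f t x"
          using vy(6)[OF t] by blast
        have "ball x (e n) \<subseteq> ball (y t) (2 * e n)"
        proof
          fix q assume "q \<in> ball x (e n)"
          then show "q \<in> ball (y t) (2 * e n)"
            using x(2) dist_triangle[of "y t" q x] by (simp add: dist_commute)
        qed
        then have "convex hull (\<Union>q\<in>ball x (e n). F t q) \<subseteq> convex hull (\<Union>q\<in>ball (y t) (2 * e n). F t q)"
          by (intro hull_mono UN_mono) auto
        then show ?thesis using f(3)[OF t x(1)] x(3) by auto
      qed
      then show ?thesis using vy(1-5) unfolding M_def by blast
    qed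
  qed (use inward R0 e in \<open>auto simp: R_def\<close>)
  then obtain v y where vm: "\<And>n. v n \<in> borel_measurable (lebesgue_on {0..T})"
    and vy: "\<And>n t. t \<in> {0..T} \<Longrightarrow> norm (v n t) \<le> m t \<and> y n t = y n 0 + integral {0..t} (v n) \<and>
        norm (y n t) \<le> R + 1 \<and> v n t \<in> convex hull (\<Union>q\<in>ball (y n t) (2 * e n). F t q)"
    and nonlocal: "\<And>n. norm (y n 0 - (1 / T) *\<^sub>R integral {0..T} (\<lambda>t. h (y n t))) \<le> 3 * e n * M"
    by metis
  have v_le: "norm (v n t) \<le> m t" and y_le: "norm (y n t) \<le> R + 1"
    and v_hull: "v n t \<in> convex hull (\<Union>q\<in>ball (y n t) (2 * e n). F t q)"
    and y_eq: "y n t = y n 0 + integral {0..t} (v n)" if "t \<in> {0..T}" for n t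
    using vy[OF that, of n] by blast+
  have v_ai: "v n absolutely_integrable_on {0..T}" for n
    by (rule measurable_bounded_by_integrable_imp_absolutely_integrable[OF vm _ m]) (use v_le in auto)
  have vint: "v n integrable_on {s..t}" if "0 \<le> s" "t \<le> T" for n s t
    by (rule absolutely_integrable_imp_integrable_subset[OF v_ai]) (use that in auto)
  have mint: "m integrable_on {s..t}" if "0 \<le> s" "t \<le> T" for s t
    by (rule absolutely_integrable_imp_integrable_subset[OF m_ai]) (use that in auto)
  \<comment> \<open>The primitive of \<open>m\<close> controls the increments of all
    \<open>y n\<close> at once; this is the equicontinuity needed for the uniform limit.\<close>
  have incr: "norm (y n t - y n s) \<le> integral {0..t} m - integral {0..s} m"
    if st: "0 \<le> s" "s \<le> t" "t \<le> T" for n s t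
  proof -
    have comb: "integral {0..s} (v n) + integral {s..t} (v n) = integral {0..t} (v n)"
      "integral {0..s} m + integral {s..t} m = integral {0..t} m"
      by (rule Henstock_Kurzweil_Integration.integral_combine; use st vint mint in auto)+
    have "y n t - y n s = integral {0..t} (v n) - integral {0..s} (v n)"
      using y_eq[of t n] y_eq[of s n] st by (metis add_diff_cancel_left atLeastAtMost_iff order_trans)
    also have "\<dots> = integral {s..t} (v n)" by (simp flip: comb(1))
    also have "norm \<dots> \<le> integral {s..t} m"
      by (rule integral_norm_bound_integral) (use st vint mint v_le in auto)
    finally show ?thesis using comb(2) by simp
  qed
  obtain g k where gk: "continuous_on {0..T} g" "strict_mono (k :: nat \<Rightarrow> nat)"
    "\<And>\<epsilon>. 0 < \<epsilon> \<Longrightarrow> \<exists>N. \<forall>n t. n \<ge> N \<and> t \<in> {0..T} \<longrightarrow> norm (y (k n) t - g t) < \<epsilon>"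
  proof (rule Arzela_Ascoli[of "{0..T}" y "R + 1"])
    show "norm (y n t) \<le> R + 1" if "t \<in> {0..T}" for n t by (rule y_le[OF that])
    fix s \<epsilon> :: real assume s: "s \<in> {0..T}" and "0 < \<epsilon>"
    have "continuous_on {0..T} (\<lambda>t. integral {0..t} m)"
      by (rule indefinite_integral_continuous_1[OF m])
    then obtain \<delta> where \<delta>: "\<delta> > 0" "\<And>t. \<lbrakk>t \<in> {0..T}; dist t s < \<delta>\<rbrakk> \<Longrightarrow>
        dist (integral {0..t} m) (integral {0..s} m) < \<epsilon>"
      using s \<open>0 < \<epsilon>\<close> unfolding continuous_on_iff by metis
    show "\<exists>d>0. \<forall>n t. t \<in> {0..T} \<and> norm (s - t) < d \<longrightarrow> norm (y n s - y n t) < \<epsilon>"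
    proof (intro exI[of _ \<delta>] conjI \<delta>(1) allI impI; elim conjE)
      fix n t assume t: "t \<in> {0..T}" "norm (s - t) < \<delta>"
      have "norm (y n s - y n t) \<le> dist (integral {0..t} m) (integral {0..s} m)"
        using incr[of s t n] incr[of t s n] s t
        by (cases "s \<le> t") (auto simp: dist_real_def norm_minus_commute)
      also have "\<dots> < \<epsilon>" using \<delta>(2)[of t] t by (simp add: dist_real_def abs_minus_commute)
      finally show "norm (y n s - y n t) < \<epsilon>" .
    qed
  qed (use that in auto)
  have y_lim: "(\<lambda>n. y (k n) t) \<longlonglongrightarrow> g t" if "t \<in> {0..T}" for t
    using gk(3) that unfolding LIMSEQ_iff by blast
  have "(e \<circ> k) \<longlonglongrightarrow> 0" using e_lim gk(2) by (rule LIMSEQ_subseq_LIMSEQ)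
  then have ek: "(\<lambda>n. c * e (k n)) \<longlonglongrightarrow> 0" for c
    using tendsto_mult_right_zero[of "\<lambda>n. e (k n)"] by (simp add: comp_def)
  interpret I: finite_measure "lebesgue_on {0..T}" by (rule finite_measure_lebesgue_on) simp
  obtain w where w: "integrable (lebesgue_on {0..T}) w"
    "AE t in lebesgue_on {0..T}. \<forall>n. w t \<in> closure (convex hull {v (k j) t | j. j \<ge> n})"
    "\<And>A L. \<lbrakk>A \<in> sets (lebesgue_on {0..T}); (\<lambda>j. LINT t:A|lebesgue_on {0..T}. v (k j) t) \<longlonglongrightarrow> L\<rbrakk>
       \<Longrightarrow> (LINT t:A|lebesgue_on {0..T}. w t) = L"
  proof (rule I.weak_sequential_limit[of "\<lambda>j. v (k j)" m])
    show "integrable (lebesgue_on {0..T}) m" using m_ai by (simp add: integrable_lebesgue_on_iff)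
  qed (use vm v_le that in auto)
  have w_ai: "w absolutely_integrable_on {0..T}" using w(1) by (simp add: integrable_lebesgue_on_iff)
  have g_eq: "g t = g 0 + integral {0..t} w" if t: "t \<in> {0..T}" for t
  proof -
    have conv: "(LINT t:{0..t}|lebesgue_on {0..T}. u t) = integral {0..t} u"
      if "u absolutely_integrable_on {0..T}" for u :: "real \<Rightarrow> 'a"
      by (rule set_lebesgue_integral_lebesgue_on[OF that]) (use t in auto)
    \<comment> \<open>These increments are the integrals of \<open>v (k j)\<close> over
      \<open>{0..t}\<close>, so convergence of the paths provides the convergence of integrals that
      determines the integral of \<open>w\<close>.\<close>
    have "(\<lambda>j. y (k j) t - y (k j) 0) \<longlonglongrightarrow> g t - g 0"
      using T t by (intro tendsto_diff y_lim) auto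
    moreover have "y (k j) t - y (k j) 0 = integral {0..t} (v (k j))" for j
      by (simp add: y_eq[OF t, of "k j"])
    ultimately have "(\<lambda>j. LINT t:{0..t}|lebesgue_on {0..T}. v (k j) t) \<longlonglongrightarrow> g t - g 0"
      by (simp add: conv v_ai)
    then have "(LINT t:{0..t}|lebesgue_on {0..T}. w t) = g t - g 0"
      by (intro w(3)) (use t in \<open>auto simp: sets_restrict_space_iff\<close>)
    then show ?thesis by (simp add: conv w_ai)
  qed
  have "AE t in lebesgue_on {0..T}. ((\<lambda>s. integral {0..s} w) has_vector_derivative w t) (at t within {0..T})"
    by (intro AE_lebesgue_on_notin_negligible negligible_not_differentiable_indefinite_integral w_ai) simp
  moreover have "AE t in lebesgue_on {0..T}. t \<in> {0..T}"
    using AE_space[of "lebesgue_on {0..T}"] by simp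
  ultimately have "AE t in lebesgue_on {0..T}. \<exists>v\<in>F t (g t). (g has_vector_derivative v) (at t within {0..T})"
    using w(2) usc
  proof eventually_elim
    case (elim t)
    have "((\<lambda>s. g 0 + integral {0..s} w) has_vector_derivative w t) (at t within {0..T})"
      using has_vector_derivative_add[OF has_vector_derivative_const elim(1), of "g 0"] by simp
    then have "(g has_vector_derivative w t) (at t within {0..T})"
      by (rule has_vector_derivative_transform[OF elim(2), rotated]) (rule g_eq)
    moreover have "w t \<in> F t (g t)"
    proof (rule usc_multimap_convex_limit[OF elim(4), of "g t" "\<lambda>j. v (k j) t" "\<lambda>j. y (k j) t" "\<lambda>j. 2 * e (k j)"])
      show "v (k j) t \<in> convex hull (\<Union>q\<in>ball (y (k j) t) (2 * e (k j)). F t q)" for j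
        by (rule v_hull[OF elim(2)])
    qed (use val[OF elim(2)] y_lim[OF elim(2)] ek elim(3) in auto)
    ultimately show ?case by blast
  qed
  then have "inclusion_solution_on {0..T} F g"
    unfolding inclusion_solution_on_def
    using absolutely_continuous_on_indefinite_integral[OF w_ai g_eq] by blast
  moreover have "g 0 = (1 / T) *\<^sub>R integral {0..T} (\<lambda>t. h (g t))"
  proof -
    let ?A = "\<lambda>z. (1 / T) *\<^sub>R integral {0..T} (\<lambda>t. h (z t))"
    have y_cont: "continuous_on {0..T} (y n)" for n
    proof -
      have "continuous_on {0..T} (\<lambda>t. y n 0 + integral {0..t} (v n))"
        by (intro continuous_intros indefinite_integral_continuous_1 vint) auto
      then show ?thesis by (rule continuous_on_eq) (rule y_eq[symmetric])
    qed
    \<comment> \<open>Continuity of \<open>h\<close> and the common bound \<open>R + 1\<close> let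
      the nonlocal mean pass to the limit, while its error is at most
      \<open>3 * M * e (k n)\<close>.\<close>
    have "(\<lambda>n. integral {0..T} (\<lambda>t. h (y (k n) t))) \<longlonglongrightarrow> integral {0..T} (\<lambda>t. h (g t))"
    proof (rule dominated_convergence(2)[where h = "\<lambda>_. R + 1"])
      show "(\<lambda>t. h (y (k n) t)) integrable_on {0..T}" for n
        by (intro integrable_continuous_real continuous_on_compose2[OF h(1) y_cont]) auto
      show "norm (h (y (k n) t)) \<le> R + 1" if "t \<in> {0..T}" for n t
        using h(2)[of "y (k n) t"] y_le[OF that, of "k n"] by linarith
      show "(\<lambda>n. h (y (k n) t)) \<longlonglongrightarrow> h (g t)" if "t \<in> {0..T}" for t
        using continuous_on_tendsto_compose[OF h(1) y_lim[OF that]] by simp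
    qed auto
    then have "(\<lambda>n. y (k n) 0 - ?A (y (k n))) \<longlonglongrightarrow> g 0 - ?A g"
      using T by (intro tendsto_intros y_lim) auto
    moreover have "(\<lambda>n. y (k n) 0 - ?A (y (k n))) \<longlonglongrightarrow> 0"
    proof (rule Lim_null_comparison[OF _ ek[of "3 * M"]])
      show "\<forall>\<^sub>F n in sequentially. norm (y (k n) 0 - ?A (y (k n))) \<le> 3 * M * e (k n)"
        using nonlocal[of "k n" for n] by (intro always_eventually allI) (simp add: mult.commute mult.left_commute)
    qed
    ultimately have "g 0 - ?A g = 0" by (rule LIMSEQ_unique)
    then show ?thesis by simp
  qed
  ultimately show ?thesis by blast
qed

theorem theorem5:
  fixes T :: real
    and h :: "real ^ 'n \<Rightarrow> real ^ 'n"
    and F :: "real \<Rightarrow> real ^ 'n \<Rightarrow> (real ^ 'n) set"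
  assumes "T > 0"
    and "continuous_on UNIV h"
    and "\<And>x. norm (h x) \<le> norm x"
    and "compact {x. h x = x}"
    and "caratheodory_map {0..T} F"
    and "\<exists>V. norm_monotone V \<and> coercive V \<and> weakly_negatively_guiding_potential {0..T} F V"
  shows "\<exists>x. inclusion_solution_on {0..T} F x \<and>
           x 0 = (1 / T) *\<^sub>R integral {0..T} (\<lambda>t. h (x t))"
proof -
  obtain V where V: "norm_monotone V" "weakly_negatively_guiding_potential {0..T} F V"
    using assms(6) by blast
  obtain R where R: "R > 0" "\<And>t x. \<lbrakk>t \<in> {0..T}; R \<le> norm x\<rbrakk> \<Longrightarrow> \<exists>y\<in>F t x. x \<bullet> y \<le> 0"
    by (rule guiding_potential_imp_inward[OF V]) (blast intro: that)
  show ?thesis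
    by (rule nonlocal_inclusion_solution[OF assms(1,2,3,5) R])
qed

end
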